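(* Let $\Gamma$ be a random edge-labelled graph on $n$ vertices with label probabilities $p_m=p_m(n)$. If $np_4\to\infty$ and $np_2\not\to 0$ (i.e. $np_2$ does not tend to $0$) as $n\to\infty$, then $W_\Gamma$ is asymptotically almost surely not hyperbolic.
   Context: Random edge-labelled graph: for each $n$, nonnegative numbers $p_m(n)$ ($m=2,3,4,\dots$) are given with $\sum_{m=2}^\infty p_m(n)\le 1$. On a vertex set of size $n$, independently for each pair of vertices, the pair is joined by an edge labelled $m$ with probability $p_m(n)$ for each integer $m\ge2$, and is not joined by an edge with the remaining probability. "Asymptotically almost surely" means with probability tending to $1$ as $n\to\infty$. Coxeter group: if $\Gamma$ has vertices $v_1,\dots,v_n$ and the edge between $v_i$ and $v_j$ (if present) has label $m_{i,j}$, then $W_\Gamma=\langle v_1,\dots,v_n\mid v_i^2,\ (v_iv_j)^{m_{i,j}}\rangle$, with the second type of relator only for adjacent pairs. A group is hyperbolic if its Cayley graph with respect to some (hence any) finite generating set is $\delta$-hyperbolic for some $\delta\ge0$, i.e. in every geodesic triangle the $\delta$-neighborhood of the union of two sides contains the third side.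
   Formalization: As stated it fails (p_4=n^{-1/2}, p_2=1/n for even n, 0 for odd n: all labels 4 for odd n, so W_Γ is hyperbolic). The a.a.s. claim is proved when liminf np_2>0; if only np_2 does not tend to 0, the probability tends to 1 along a subsequence of n. *)

theory Defs
  imports
    "HOL-Probability.Probability"
    "HOL-Algebra.Generated_Groups"
begin

section \<open>Groups given by generators and relators\<close>

text \<open>A word over \<open>S\<close> is a list of letters \<open>(s, True)\<close>, standing for \<open>s\<close>, and \<open>(s, False)\<close>,
  standing for the formal inverse of \<open>s\<close>.\<close>

type_synonym 'a word = "('a \<times> bool) list"

definition words :: "'a set \<Rightarrow> 'a word set" where
  "words S = lists (S \<times> UNIV)"

inductive word_eq :: "'a set \<Rightarrow> 'a word set \<Rightarrow> 'a word \<Rightarrow> 'a word \<Rightarrow> bool"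
  for S :: "'a set" and R :: "'a word set" where
  refl: "u \<in> words S \<Longrightarrow> word_eq S R u u"
| sym: "word_eq S R u v \<Longrightarrow> word_eq S R v u"
| trans: "word_eq S R u v \<Longrightarrow> word_eq S R v w \<Longrightarrow> word_eq S R u w"
| cancel: "u \<in> words S \<Longrightarrow> v \<in> words S \<Longrightarrow> s \<in> S \<Longrightarrow>
    word_eq S R (u @ [(s, b), (s, \<not> b)] @ v) (u @ v)"
| relator: "u \<in> words S \<Longrightarrow> v \<in> words S \<Longrightarrow> r \<in> R \<Longrightarrow> r \<in> words S \<Longrightarrow>
    word_eq S R (u @ r @ v) (u @ v)"

definition word_class :: "'a set \<Rightarrow> 'a word set \<Rightarrow> 'a word \<Rightarrow> 'a word set" where
  "word_class S R u = {v. word_eq S R u v}"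

definition presented_group :: "'a set \<Rightarrow> 'a word set \<Rightarrow> 'a word set monoid" where
  "presented_group S R =
    \<lparr> carrier = word_class S R ` words S,
      mult = (\<lambda>A B. \<Union>u\<in>A. \<Union>v\<in>B. word_class S R (u @ v)),
      one = word_class S R [] \<rparr>"

lemma words_append [simp]: "u @ v \<in> words S \<longleftrightarrow> u \<in> words S \<and> v \<in> words S"
  by (auto simp: words_def)

lemma words_Nil [simp]: "[] \<in> words S"
  by (simp add: words_def)

lemma words_Cons [simp]: "x # u \<in> words S \<longleftrightarrow> fst x \<in> S \<and> u \<in> words S"
  by (cases x) (auto simp: words_def)

lemma word_eq_words: "word_eq S R u v \<Longrightarrow> u \<in> words S \<and> v \<in> words S"
  by (induction rule: word_eq.induct) auto

lemma word_eq_append_left: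
  assumes "word_eq S R u v" "w \<in> words S"
  shows "word_eq S R (w @ u) (w @ v)"
  using assms
proof (induction rule: word_eq.induct)
  case (cancel u v s b)
  then show ?case
    using word_eq.cancel[of "w @ u" S v s R b] by simp
next
  case (relator u v r)
  then show ?case
    using word_eq.relator[of "w @ u" S v r R] by simp
qed (auto intro: word_eq.intros)

lemma word_eq_append_right:
  assumes "word_eq S R u v" "w \<in> words S"
  shows "word_eq S R (u @ w) (v @ w)"
  using assms
proof (induction rule: word_eq.induct)
  case (cancel u v s b)
  then show ?case
    using word_eq.cancel[of u S "v @ w" s R b] by simp
next
  case (relator u v r)
  then show ?case
    using word_eq.relator[of u S "v @ w" r R] by simp
qed (auto intro: word_eq.intros)

lemma word_eq_append:
  assumes "word_eq S R u u'" "word_eq S R v v'"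
  shows "word_eq S R (u @ v) (u' @ v')"
proof (rule word_eq.trans)
  show "word_eq S R (u @ v) (u' @ v)"
    using assms word_eq_words by (blast intro: word_eq_append_right)
  show "word_eq S R (u' @ v) (u' @ v')"
    using assms word_eq_words by (blast intro: word_eq_append_left)
qed

lemma word_class_eq_iff:
  assumes "u \<in> words S"
  shows "word_class S R u = word_class S R v \<longleftrightarrow> word_eq S R u v"
proof
  assume "word_class S R u = word_class S R v"
  moreover have "u \<in> word_class S R u"
    using assms by (simp add: word_class_def word_eq.refl)
  ultimately show "word_eq S R u v"
    by (simp add: word_class_def word_eq.sym)
next
  assume "word_eq S R u v"
  then show "word_class S R u = word_class S R v"
    unfolding word_class_def
    using word_eq.sym[of S R u v] word_eq.trans[of S R u v] word_eq.trans[of S R v u] by blast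
qed

lemma carrier_presented_group: "carrier (presented_group S R) = word_class S R ` words S"
  by (simp add: presented_group_def)

lemma presented_group_mult_def:
  "A \<otimes>\<^bsub>presented_group S R\<^esub> B = (\<Union>u\<in>A. \<Union>v\<in>B. word_class S R (u @ v))"
  by (simp add: presented_group_def)

lemma presented_group_mult:
  assumes "u \<in> words S" "v \<in> words S"
  shows "word_class S R u \<otimes>\<^bsub>presented_group S R\<^esub> word_class S R v = word_class S R (u @ v)"
proof -
  have const: "word_class S R (u' @ v') = word_class S R (u @ v)"
    if "u' \<in> word_class S R u" "v' \<in> word_class S R v" for u' v'
  proof -
    have "word_eq S R u u'" "word_eq S R v v'"
      using that by (simp_all only: word_class_def mem_Collect_eq)
    then have "word_eq S R (u @ v) (u' @ v')"
      by (rule word_eq_append)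
    moreover have "u @ v \<in> words S"
      using assms by simp
    ultimately show ?thesis
      using word_class_eq_iff[of "u @ v" S R "u' @ v'"] by simp
  qed
  have ne: "u \<in> word_class S R u" "v \<in> word_class S R v"
    using assms by (simp_all add: word_class_def word_eq.refl)
  let ?U = "\<Union>a\<in>word_class S R u. \<Union>b\<in>word_class S R v. word_class S R (a @ b)"
  have "?U = word_class S R (u @ v)"
  proof (rule equalityI)
    show "?U \<subseteq> word_class S R (u @ v)"
      by (intro UN_least) (simp only: const order_refl)
    show "word_class S R (u @ v) \<subseteq> ?U"
      by (rule subset_trans[OF UN_upper[OF ne(2)] UN_upper[OF ne(1)]])
  qed
  then show ?thesis
    by (simp only: presented_group_mult_def)
qed

lemma word_eq_inverse:
  "u \<in> words S \<Longrightarrow> word_eq S R (rev (map (\<lambda>(s, b). (s, \<not> b)) u) @ u) []"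
proof (induction u)
  case Nil
  then show ?case by (simp add: word_eq.refl)
next
  case (Cons x u)
  obtain s b where x: "x = (s, b)" by (cases x)
  let ?w = "rev (map (\<lambda>(s, b). (s, \<not> b)) u)"
  have w: "?w \<in> words S"
    using Cons.prems by (auto simp: words_def)
  have "word_eq S R (?w @ [(s, \<not> b), (s, \<not> \<not> b)] @ u) (?w @ u)"
    using Cons.prems w x by (intro word_eq.cancel) simp_all
  then show ?case
    using word_eq.trans[OF _ Cons.IH] Cons.prems x by simp
qed

lemma group_presented_group: "group (presented_group S R)"
proof (rule groupI)
  fix x y z
  assume "x \<in> carrier (presented_group S R)" "y \<in> carrier (presented_group S R)"
    "z \<in> carrier (presented_group S R)"
  then show "x \<otimes>\<^bsub>presented_group S R\<^esub> y \<otimes>\<^bsub>presented_group S R\<^esub> z =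
    x \<otimes>\<^bsub>presented_group S R\<^esub> (y \<otimes>\<^bsub>presented_group S R\<^esub> z)"
    by (auto simp: carrier_presented_group presented_group_mult)
next
  fix x y
  assume "x \<in> carrier (presented_group S R)" "y \<in> carrier (presented_group S R)"
  then show "x \<otimes>\<^bsub>presented_group S R\<^esub> y \<in> carrier (presented_group S R)"
    by (auto simp: carrier_presented_group presented_group_mult)
next
  show "\<one>\<^bsub>presented_group S R\<^esub> \<in> carrier (presented_group S R)"
    by (auto simp: presented_group_def)
next
  fix x
  assume "x \<in> carrier (presented_group S R)"
  then obtain u where u: "u \<in> words S" "x = word_class S R u"
    by (auto simp: presented_group_def)
  have one: "\<one>\<^bsub>presented_group S R\<^esub> = word_class S R []"
    by (simp add: presented_group_def)
  show "\<one>\<^bsub>presented_group S R\<^esub> \<otimes>\<^bsub>presented_group S R\<^esub> x = x"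
    using u presented_group_mult[of "[]" S u R] by (simp add: one)
  let ?w = "rev (map (\<lambda>(s, b). (s, \<not> b)) u)"
  have w: "?w \<in> words S"
    using u by (auto simp: words_def)
  have "word_class S R ?w \<otimes>\<^bsub>presented_group S R\<^esub> x = \<one>\<^bsub>presented_group S R\<^esub>"
    using u w by (simp add: one presented_group_mult word_class_eq_iff word_eq_inverse)
  moreover have "word_class S R ?w \<in> carrier (presented_group S R)"
    using w by (simp add: presented_group_def)
  ultimately show "\<exists>y\<in>carrier (presented_group S R).
      y \<otimes>\<^bsub>presented_group S R\<^esub> x = \<one>\<^bsub>presented_group S R\<^esub>"
    by blast
qed

lemma generate_presented_group:
  "generate (presented_group S R) ((\<lambda>s. word_class S R [(s, True)]) ` S) =
    carrier (presented_group S R)"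
proof -
  interpret G: group "presented_group S R"
    by (rule group_presented_group)
  let ?X = "(\<lambda>s. word_class S R [(s, True)]) ` S"
  have one: "\<one>\<^bsub>presented_group S R\<^esub> = word_class S R []"
    by (simp add: presented_group_def)
  have letter: "word_class S R [(s, b)] \<in> generate (presented_group S R) ?X" if s: "s \<in> S" for s b
  proof (cases b)
    case True
    then show ?thesis
      using generate.incl[of _ ?X, OF imageI[OF s]] by simp
  next
    case False
    have "word_eq S R [(s, False), (s, True)] []"
      using word_eq.cancel[of "[]" S "[]" s R False] s by simp
    then have "word_class S R [(s, False)] \<otimes>\<^bsub>presented_group S R\<^esub> word_class S R [(s, True)] =
        \<one>\<^bsub>presented_group S R\<^esub>"
      using s by (simp add: one presented_group_mult word_class_eq_iff)
    moreover have "word_class S R [(s, b)] \<in> carrier (presented_group S R)" for b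
      unfolding carrier_presented_group using s by (intro imageI) simp
    ultimately have "inv\<^bsub>presented_group S R\<^esub> word_class S R [(s, True)] = word_class S R [(s, False)]"
      by (intro G.inv_equality)
    moreover have "inv\<^bsub>presented_group S R\<^esub> word_class S R [(s, True)]
        \<in> generate (presented_group S R) ?X"
      by (rule generate.inv) (rule imageI[OF s])
    ultimately show ?thesis
      using False by simp
  qed
  have "word_class S R u \<in> generate (presented_group S R) ?X" if "u \<in> words S" for u
    using that
  proof (induction u)
    case Nil
    then show ?case
      using generate.one[of "presented_group S R" ?X] by (simp only: one)
  next
    case (Cons x u)
    then have "word_class S R (x # u) =
        word_class S R [x] \<otimes>\<^bsub>presented_group S R\<^esub> word_class S R u"
      by (simp add: presented_group_mult)
    then show ?case
      using Cons letter[of "fst x" "snd x"] by (simp add: generate.eng)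
  qed
  then have "carrier (presented_group S R) \<subseteq> generate (presented_group S R) ?X"
    unfolding carrier_presented_group by (rule image_subsetI)
  moreover have "?X \<subseteq> carrier (presented_group S R)"
    unfolding carrier_presented_group by (intro image_subsetI imageI) simp
  ultimately show ?thesis
    using G.generate_incl[of ?X] by (simp only: subset_antisym)
qed


section \<open>Edge-labelled graphs and Coxeter groups\<close>

text \<open>An edge-labelled graph on \<open>{..<n}\<close> maps each pair \<open>{i, j}\<close> of vertices to \<open>Some m\<close> if it is
  joined by an edge labelled \<open>m\<close>, and to \<open>None\<close> if it is not joined by an edge.\<close>

type_synonym labelled_graph = "nat set \<Rightarrow> nat option"

definition vertex_pairs :: "nat \<Rightarrow> nat set set" where
  "vertex_pairs n = {e. e \<subseteq> {..<n} \<and> card e = 2}"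

definition coxeter_relators :: "nat \<Rightarrow> labelled_graph \<Rightarrow> nat word set" where
  "coxeter_relators n \<Gamma> =
    {[(i, True), (i, True)] | i. i < n} \<union>
    {concat (replicate m [(i, True), (j, True)]) | i j m.
       i < n \<and> j < n \<and> i \<noteq> j \<and> \<Gamma> {i, j} = Some m}"

definition coxeter_group :: "nat \<Rightarrow> labelled_graph \<Rightarrow> nat word set monoid" where
  "coxeter_group n \<Gamma> = presented_group {..<n} (coxeter_relators n \<Gamma>)"


section \<open>Random edge-labelled graphs\<close>

definition label_probabilities :: "(nat \<Rightarrow> nat \<Rightarrow> real) \<Rightarrow> bool" where
  "label_probabilities p \<longleftrightarrow>
    (\<forall>n. (\<forall>m\<ge>2. 0 \<le> p m n) \<and> (\<lambda>m. p m n) summable_on {2..} \<and> (\<Sum>\<^sub>\<infinity>m\<in>{2..}. p m n) \<le> 1)"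

definition edge_label_pmf :: "(nat \<Rightarrow> nat \<Rightarrow> real) \<Rightarrow> nat \<Rightarrow> nat option pmf" where
  "edge_label_pmf p n = embed_pmf (\<lambda>x. case x of
      None \<Rightarrow> 1 - (\<Sum>\<^sub>\<infinity>m\<in>{2..}. p m n)
    | Some m \<Rightarrow> if 2 \<le> m then p m n else 0)"

definition random_graph :: "(nat \<Rightarrow> nat \<Rightarrow> real) \<Rightarrow> nat \<Rightarrow> labelled_graph pmf" where
  "random_graph p n = Pi_pmf (vertex_pairs n) None (\<lambda>_. edge_label_pmf p n)"

lemma finite_vertex_pairs: "finite (vertex_pairs n)"
  by (rule finite_subset[of _ "Pow {..<n}"]) (auto simp: vertex_pairs_def)

lemma pmf_edge_label_pmf:
  assumes "label_probabilities p"
  shows "pmf (edge_label_pmf p n) x = (case x of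
      None \<Rightarrow> 1 - (\<Sum>\<^sub>\<infinity>m\<in>{2..}. p m n)
    | Some m \<Rightarrow> if 2 \<le> m then p m n else 0)"
proof -
  let ?f = "\<lambda>x. case x of
      None \<Rightarrow> 1 - (\<Sum>\<^sub>\<infinity>m\<in>{2..}. p m n)
    | Some m \<Rightarrow> if 2 \<le> m then p m n else 0"
  let ?g = "\<lambda>m. if 2 \<le> m then p m n else 0"
  have pos: "0 \<le> p m n" if "2 \<le> m" for m
    using assms that by (auto simp: label_probabilities_def)
  have summ: "(\<lambda>m. p m n) summable_on {2..}" and le: "(\<Sum>\<^sub>\<infinity>m\<in>{2..}. p m n) \<le> 1"
    using assms by (auto simp: label_probabilities_def)
  have "(?g has_sum (\<Sum>\<^sub>\<infinity>m\<in>{2..}. p m n)) UNIV"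
  proof -
    have "((\<lambda>m. p m n) has_sum (\<Sum>\<^sub>\<infinity>m\<in>{2..}. p m n)) {2..}"
      using summ by simp
    moreover have "(?g has_sum c) UNIV \<longleftrightarrow> ((\<lambda>m. p m n) has_sum c) {2..}" for c
      by (rule has_sum_cong_neutral) auto
    ultimately show ?thesis
      by blast
  qed
  then have sums: "?g sums (\<Sum>\<^sub>\<infinity>m\<in>{2..}. p m n)"
    by (rule has_sum_imp_sums)
  have "(\<integral>\<^sup>+ x. ennreal (?f x) \<partial>count_space UNIV)
      = (\<integral>\<^sup>+ x \<in> {None} \<union> range Some. ennreal (?f x) \<partial>count_space UNIV)"
    by (simp add: UNIV_option_conv[symmetric])
  also have "\<dots> = (\<integral>\<^sup>+ x \<in> {None}. ennreal (?f x) \<partial>count_space UNIV)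
      + (\<integral>\<^sup>+ x \<in> range Some. ennreal (?f x) \<partial>count_space UNIV)"
    by (rule nn_integral_disjoint_pair_countspace) auto
  also have "(\<integral>\<^sup>+ x \<in> range Some. ennreal (?f x) \<partial>count_space UNIV)
      = (\<integral>\<^sup>+ x. ennreal (?f x) \<partial>count_space (range Some))"
    by (simp add: nn_integral_count_space_indicator)
  also have "\<dots> = (\<integral>\<^sup>+ m. ennreal (?f (Some m)) \<partial>count_space UNIV)"
    by (rule nn_integral_bij_count_space[symmetric]) (simp add: bij_betw_def)
  also have "\<dots> = ennreal (\<Sum>\<^sub>\<infinity>m\<in>{2..}. p m n)"
    using sums pos
    by (subst nn_integral_count_space_nat, subst suminf_ennreal2) (auto simp: sums_iff)
  also have "(\<integral>\<^sup>+ x \<in> {None}. ennreal (?f x) \<partial>count_space UNIV)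
      = ennreal (1 - (\<Sum>\<^sub>\<infinity>m\<in>{2..}. p m n))"
    by simp
  also have "ennreal (1 - (\<Sum>\<^sub>\<infinity>m\<in>{2..}. p m n)) + ennreal (\<Sum>\<^sub>\<infinity>m\<in>{2..}. p m n) = 1"
    using le pos by (subst ennreal_plus[symmetric]) (auto intro: infsum_nonneg)
  finally show ?thesis
    unfolding edge_label_pmf_def using le pos
    by (subst pmf_embed_pmf) (auto split: option.split)
qed


section \<open>Metric graphs and hyperbolic groups\<close>

definition graph_dist :: "'a set set \<Rightarrow> 'a \<Rightarrow> 'a \<Rightarrow> nat" where
  "graph_dist E u v =
    (LEAST k. \<exists>w. w 0 = u \<and> w k = v \<and> (\<forall>i<k. {w i, w (Suc i)} \<in> E))"

text \<open>The geometric realization of a graph with vertex set \<open>V\<close> and edge set \<open>E\<close> (a set of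
  two-element subsets of \<open>V\<close>). A point is given by its barycentric coordinates: the vertex \<open>v\<close> is the
  indicator function of \<open>{v}\<close>, and the point of the edge \<open>{u, v}\<close> at distance \<open>t\<close> from \<open>u\<close> has
  coordinates \<open>1 - t\<close> at \<open>u\<close>, \<open>t\<close> at \<open>v\<close>, and 0 elsewhere.\<close>

definition supp :: "('a \<Rightarrow> real) \<Rightarrow> 'a set" where
  "supp a = {v. a v \<noteq> 0}"

definition realization :: "'a set \<Rightarrow> 'a set set \<Rightarrow> ('a \<Rightarrow> real) set" where
  "realization V E = {a. (\<forall>v. 0 \<le> a v) \<and> (\<Sum>v\<in>supp a. a v) = 1 \<and>
    (supp a \<in> E \<or> (\<exists>v\<in>V. supp a = {v}))}"

text \<open>The path metric of a connected graph all of whose edges have length 1. On a common edge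
  \<open>{u, v}\<close> the distance is \<open>\<bar>a u - b u\<bar> = \<bar>a v - b v\<bar>\<close>. Otherwise a shortest path from \<open>a\<close> to \<open>b\<close>
  leaves the edge of \<open>a\<close> through some end \<open>u\<close>, which is at distance \<open>1 - a u\<close> from \<open>a\<close>, and enters
  the edge of \<open>b\<close> through some end \<open>v\<close>, which is at distance \<open>1 - b v\<close> from \<open>b\<close>.\<close>

definition realization_dist :: "'a set set \<Rightarrow> ('a \<Rightarrow> real) \<Rightarrow> ('a \<Rightarrow> real) \<Rightarrow> real" where
  "realization_dist E a b =
    (if \<exists>e\<in>E. supp a \<union> supp b \<subseteq> e
     then Max {\<bar>a v - b v\<bar> | v. v \<in> supp a \<union> supp b}
     else Min {(1 - a u) + real (graph_dist E u v) + (1 - b v) | u v. u \<in> supp a \<and> v \<in> supp b})"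

definition geodesic_segment ::
  "'x set \<Rightarrow> ('x \<Rightarrow> 'x \<Rightarrow> real) \<Rightarrow> 'x \<Rightarrow> 'x \<Rightarrow> 'x set \<Rightarrow> bool" where
  "geodesic_segment X d x y A \<longleftrightarrow>
    (\<exists>L\<ge>0. \<exists>\<gamma>. \<gamma> 0 = x \<and> \<gamma> L = y \<and> A = \<gamma> ` {0..L} \<and> A \<subseteq> X \<and>
       (\<forall>s\<in>{0..L}. \<forall>t\<in>{0..L}. d (\<gamma> s) (\<gamma> t) = \<bar>s - t\<bar>))"

definition delta_hyperbolic :: "'x set \<Rightarrow> ('x \<Rightarrow> 'x \<Rightarrow> real) \<Rightarrow> real \<Rightarrow> bool" where
  "delta_hyperbolic X d \<delta> \<longleftrightarrow>
    (\<forall>x y z A B C. geodesic_segment X d x y A \<longrightarrow> geodesic_segment X d y z B \<longrightarrow>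
       geodesic_segment X d z x C \<longrightarrow> (\<forall>a\<in>A. \<exists>b\<in>B \<union> C. d a b \<le> \<delta>))"

definition cayley_edges :: "('g, 'b) monoid_scheme \<Rightarrow> 'g set \<Rightarrow> 'g set set" where
  "cayley_edges G S = {{g, g \<otimes>\<^bsub>G\<^esub> s} | g s. g \<in> carrier G \<and> s \<in> S \<and> g \<otimes>\<^bsub>G\<^esub> s \<noteq> g}"

definition hyperbolic_group :: "('g, 'b) monoid_scheme \<Rightarrow> bool" where
  "hyperbolic_group G \<longleftrightarrow>
    (\<exists>S \<delta>. finite S \<and> S \<subseteq> carrier G \<and> generate G S = carrier G \<and> 0 \<le> \<delta> \<and>
       delta_hyperbolic (realization (carrier G) (cayley_edges G S))
         (realization_dist (cayley_edges G S)) \<delta>)"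

end

theory Submission
  imports Defs
begin

text \<open>
  The obstruction to hyperbolicity is a triangle \<open>a, b, c\<close> whose sides \<open>{a, b}\<close>, \<open>{a, c}\<close> carry the
  label 4 and whose side \<open>{b, c}\<close> carries the label 2. The expected number of such triangles has
  order \<open>n\<^sup>3 p\<^sub>4\<^sup>2 p\<^sub>2 = (n p\<^sub>4)\<^sup>2 (n p\<^sub>2)\<close>, which tends to infinity as long as \<open>n p\<^sub>2\<close> stays away from 0,
  and the second moment method shows that one exists with probability tending to 1. Since \<open>n p\<^sub>2\<close>
  need not stay away from 0 along all \<open>n\<close>, everything is done along a sequence \<open>r\<close> on which it does
  (\<open>prob_not_hyperbolic_tendsto\<close>).

  The reflections in the sides of a right isosceles Euclidean triangle satisfy the relations of
  \<open>a, b, c\<close>: \<open>b\<close> and \<open>c\<close> are the legs, \<open>a\<close> is the hypotenuse. The words \<open>acab\<close> and \<open>abac\<close>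
  are perpendicular translations of this plane, and they commute in the Coxeter group
  (\<open>translations_commute\<close>). What has to be shown is that the resulting flat is undistorted: no word
  in all the generators can represent \<open>g\<^sup>i h\<^sup>j\<close> much more economically than the obvious one. For
  this the group acts on vectors by the geometric representation, and a word is assigned, for every
  vector \<open>x\<close>, the signed number of times it crosses the mirror with normal \<open>x\<close> (\<open>crossing\<close>). A
  letter crosses one mirror, so the total number of crossings is at most the length
  (\<open>crossing_sum_le_length\<close>); the relators cross every mirror as often in one direction as in the
  other, so the number depends only on the group element (\<open>word_eq_walk_crossing\<close>). In the plane
  of the triangle it can be read off from the end points of the path, and \<open>g\<^sup>i h\<^sup>j\<close> crosses \<open>2 i\<close>
  parallel mirrors (\<open>translation_length\<close>).

  A hyperbolic group has no undistorted flat (\<open>not_hyperbolic_if_undistorted_flat\<close>). Slim triangles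
  give the four-point inequality (\<open>four_point\<close>), which for commuting \<open>u, v\<close> reads
  \<open>|u v| + |u v\<^sup>-\<^sup>1| \<le> 2 max |u| |v| + D\<close>. Applied to \<open>u, v\<close> and then to \<open>u v, u v\<^sup>-\<^sup>1\<close>, with \<open>u\<close> and
  \<open>v\<close> large powers of \<open>g\<close> and \<open>h\<close> of about the same length, it bounds \<open>|u\<^sup>2| + |v\<^sup>2|\<close> by
  \<open>4 max |u| |v|\<close> minus a linear term. But \<open>|u\<^sup>2|\<close> and \<open>|v\<^sup>2|\<close> are nearly \<open>2 |u|\<close> and \<open>2 |v|\<close> if
  the powers nearly attain the stable lengths.
\<close>

section \<open>Slim triangles and the four-point inequality\<close>

definition path_between :: "'a set set \<Rightarrow> 'a \<Rightarrow> 'a \<Rightarrow> nat \<Rightarrow> (nat \<Rightarrow> 'a) \<Rightarrow> bool" where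
  "path_between E u v k w \<longleftrightarrow> w 0 = u \<and> w k = v \<and> (\<forall>i<k. {w i, w (Suc i)} \<in> E)"

lemma path_between_append:
  assumes "path_between E u v k w" "path_between E v x l w'"
  shows "path_between E u x (k + l) (\<lambda>i. if i \<le> k then w i else w' (i - k))"
proof -
  have "{if i \<le> k then w i else w' (i - k), if Suc i \<le> k then w (Suc i) else w' (Suc i - k)} \<in> E"
    if il: "i < k + l" for i
  proof -
    consider "i < k" | "i = k" "0 < l" | "k < i"
      using il by (cases "i < k"; cases "i = k") auto
    then show ?thesis
    proof cases
      case 3
      then have "{w' (i - k), w' (Suc (i - k))} \<in> E"
        using assms il by (auto simp: path_between_def)
      then show ?thesis using 3 by (simp add: Suc_diff_le)
    qed (use assms in \<open>auto simp: path_between_def\<close>)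
  qed
  then show ?thesis using assms by (auto simp: path_between_def)
qed

lemma path_between_rev:
  assumes "path_between E u v k w"
  shows "path_between E v u k (\<lambda>i. w (k - i))"
proof -
  have "{w (k - i), w (k - Suc i)} \<in> E" if "i < k" for i
  proof -
    have "{w (k - Suc i), w (Suc (k - Suc i))} \<in> E"
      using assms that by (auto simp: path_between_def)
    then show ?thesis using that by (simp add: Suc_diff_Suc insert_commute)
  qed
  then show ?thesis using assms by (auto simp: path_between_def)
qed

lemma path_between_sub:
  assumes "path_between E u v k w" "i \<le> j" "j \<le> k"
  shows "path_between E (w i) (w j) (j - i) (\<lambda>l. w (i + l))"
  using assms by (auto simp: path_between_def)

locale connected_graph =
  fixes V :: "'a set" and E :: "'a set set"
  assumes edge_ends: "e \<in> E \<Longrightarrow> \<exists>u\<in>V. \<exists>v\<in>V. u \<noteq> v \<and> e = {u, v}"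
    and connected: "u \<in> V \<Longrightarrow> v \<in> V \<Longrightarrow> \<exists>k w. path_between E u v k w"
begin

abbreviation d :: "'a \<Rightarrow> 'a \<Rightarrow> nat" where "d \<equiv> graph_dist E"

lemma graph_dist_le: "path_between E u v k w \<Longrightarrow> d u v \<le> k"
  unfolding graph_dist_def path_between_def by (rule Least_le) blast

lemma shortest_path:
  assumes "u \<in> V" "v \<in> V"
  obtains w where "path_between E u v (d u v) w"
proof -
  have "\<exists>w. path_between E u v (LEAST k. \<exists>w. path_between E u v k w) w"
    using connected[OF assms] by (rule LeastI_ex)
  then show thesis
    using that by (auto simp: graph_dist_def path_between_def)
qed

lemma graph_dist_refl: "d u u = 0"
  using graph_dist_le[of u u 0 "\<lambda>_. u"] by (simp add: path_between_def)

lemma graph_dist_sym: assumes "u \<in> V" "v \<in> V" shows "d u v = d v u"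
  using assms by (metis shortest_path graph_dist_le path_between_rev le_antisym)

lemma graph_dist_triangle:
  assumes "u \<in> V" "v \<in> V" "x \<in> V"
  shows "d u x \<le> d u v + d v x"
  using assms by (metis shortest_path graph_dist_le path_between_append)

lemma graph_dist_edge: "e \<in> E \<Longrightarrow> u \<in> e \<Longrightarrow> v \<in> e \<Longrightarrow> d u v \<le> 1"
proof -
  assume e: "e \<in> E" "u \<in> e" "v \<in> e"
  show ?thesis
  proof (cases "u = v")
    case False
    then have "e = {u, v}" using edge_ends[OF e(1)] e by auto
    then show ?thesis
      using e graph_dist_le[of u v 1 "\<lambda>i. if i = 0 then u else v"] by (auto simp: path_between_def)
  qed (simp add: graph_dist_refl)
qed

definition geodesic :: "'a \<Rightarrow> 'a \<Rightarrow> nat \<Rightarrow> (nat \<Rightarrow> 'a) \<Rightarrow> bool" where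
  "geodesic u v L w \<longleftrightarrow> path_between E u v L w \<and> (\<forall>i\<le>L. w i \<in> V) \<and>
    (\<forall>i\<le>L. \<forall>j\<le>L. real (d (w i) (w j)) = \<bar>real i - real j\<bar>)"

lemma geodesic_exists:
  assumes uv: "u \<in> V" "v \<in> V"
  obtains w where "geodesic u v (d u v) w"
proof -
  obtain w where w: "path_between E u v (d u v) w"
    using shortest_path[OF uv] .
  let ?L = "d u v"
  have V: "w i \<in> V" if "i \<le> ?L" for i
  proof (cases i)
    case 0
    then show ?thesis using w uv by (simp add: path_between_def)
  next
    case (Suc j)
    then have "{w j, w (Suc j)} \<in> E" using w that by (auto simp: path_between_def)
    from edge_ends[OF this] show ?thesis using Suc by (auto simp: doubleton_eq_iff)
  qed
  have le: "d (w i) (w j) = j - i" if "i \<le> j" "j \<le> ?L" for i j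
  proof (rule antisym)
    show "d (w i) (w j) \<le> j - i"
      using graph_dist_le[OF path_between_sub[OF w that]] .
    have "d u (w i) \<le> i" "d (w j) v \<le> ?L - j"
      using graph_dist_le[OF path_between_sub[OF w, of 0 i]]
        graph_dist_le[OF path_between_sub[OF w, of j ?L]] w that
      by (auto simp: path_between_def)
    moreover have "?L \<le> d u (w i) + d (w i) (w j) + d (w j) v"
      using graph_dist_triangle[of u "w i" v] graph_dist_triangle[of "w i" "w j" v] V that uv by force
    ultimately show "j - i \<le> d (w i) (w j)" using that by linarith
  qed
  have dist: "real (d (w i) (w j)) = \<bar>real i - real j\<bar>" if "i \<le> ?L" "j \<le> ?L" for i j
  proof (cases "i \<le> j")
    case True
    then show ?thesis using le that by (simp add: of_nat_diff)
  next
    case False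
    then have "d (w i) (w j) = i - j" using le[of j i] that V graph_dist_sym by simp
    then show ?thesis using False by (simp add: of_nat_diff)
  qed
  have "geodesic u v ?L w"
    unfolding geodesic_def using w V dist by blast
  then show thesis by (rule that)
qed

lemma realization_dist_sym:
  assumes "supp a \<subseteq> V" "supp b \<subseteq> V"
  shows "realization_dist E a b = realization_dist E b a"
proof -
  have 1: "{\<bar>a v - b v\<bar> | v. v \<in> supp a \<union> supp b} = {\<bar>b v - a v\<bar> | v. v \<in> supp b \<union> supp a}"
    by (simp add: abs_minus_commute Un_commute)
  have "(1 - a u) + real (graph_dist E u v) + (1 - b v) = (1 - b v) + real (graph_dist E v u) + (1 - a u)"
    if "u \<in> supp a" "v \<in> supp b" for u v
    using graph_dist_sym[of u v] that assms by auto
  then have 2: "{(1 - a u) + real (graph_dist E u v) + (1 - b v) | u v. u \<in> supp a \<and> v \<in> supp b} =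
      {(1 - b u) + real (graph_dist E u v) + (1 - a v) | u v. u \<in> supp b \<and> v \<in> supp a}"
    by (smt (verit, ccfv_threshold) Collect_cong)
  show ?thesis
    unfolding realization_dist_def 1 2 by (simp add: Un_commute)
qed

text \<open>
  The unit-speed parametrization of a geodesic edge path as tent functions: the vertex \<open>w i\<close> has
  weight \<open>1 - \<bar>t - i\<bar>\<close> while \<open>t\<close> is within 1 of \<open>i\<close>. One formula covers vertices and points inside
  an edge, so that no case distinction enters the definition.
\<close>
definition path_point :: "nat \<Rightarrow> (nat \<Rightarrow> 'a) \<Rightarrow> real \<Rightarrow> 'a \<Rightarrow> real" where
  "path_point L w t v = (\<Sum>i\<le>L. if v = w i then max 0 (1 - \<bar>t - real i\<bar>) else 0)"

context
  fixes u v :: 'a and L :: nat and w :: "nat \<Rightarrow> 'a"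
  assumes geo: "geodesic u v L w"
begin

lemma geodesic_inj: "i \<le> L \<Longrightarrow> j \<le> L \<Longrightarrow> w i = w j \<longleftrightarrow> i = j"
  using geo graph_dist_refl by (fastforce simp: geodesic_def)

lemma geodesic_V: "i \<le> L \<Longrightarrow> w i \<in> V"
  using geo by (simp add: geodesic_def)

lemma geodesic_E: "i < L \<Longrightarrow> {w i, w (Suc i)} \<in> E"
  using geo by (simp add: geodesic_def path_between_def)

lemma path_point_at: "i \<le> L \<Longrightarrow> path_point L w t (w i) = max 0 (1 - \<bar>t - real i\<bar>)"
proof -
  assume i: "i \<le> L"
  have "path_point L w t (w i) = (\<Sum>j\<le>L. if i = j then max 0 (1 - \<bar>t - real j\<bar>) else 0)"
    unfolding path_point_def by (intro sum.cong) (use i geodesic_inj in auto)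
  then show ?thesis using i by simp
qed

lemma path_point_off: "x \<notin> w ` {..L} \<Longrightarrow> path_point L w t x = 0"
  unfolding path_point_def by (intro sum.neutral) auto

text \<open>The indices of the vertices in the support of \<open>path_point\<close> at time \<open>t\<close>: for \<open>0 \<le> t \<le> L\<close>
  one if \<open>t\<close> is an integer and two otherwise.\<close>
definition near :: "real \<Rightarrow> nat set" where
  "near t = {i. i \<le> L \<and> \<bar>t - real i\<bar> < 1}"

lemma supp_path_point: "supp (path_point L w t) = w ` near t"
proof (intro equalityI subsetI)
  fix x assume x: "x \<in> supp (path_point L w t)"
  then obtain i where i: "i \<le> L" "x = w i"
    using path_point_off[of x t] by (auto simp: supp_def)
  then show "x \<in> w ` near t"
    using x path_point_at[of i t] by (auto simp: supp_def near_def)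
qed (auto simp: supp_def near_def path_point_at)

lemma near_of_nat: "k \<le> L \<Longrightarrow> near (real k) = {k}"
  by (auto simp: near_def)

lemma near_between: "k < L \<Longrightarrow> real k < t \<Longrightarrow> t < real k + 1 \<Longrightarrow> near t = {k, Suc k}"
  by (auto simp: near_def)

lemma unit_interval_cases:
  assumes "0 \<le> t" "t \<le> real L"
  obtains k where "k \<le> L" "t = real k" | k where "k < L" "real k < t" "t < real k + 1"
proof -
  define k where "k = nat \<lfloor>t\<rfloor>"
  have k: "real k \<le> t" "t < real k + 1" using assms by (auto simp: k_def)
  then have "k \<le> L" using assms by linarith
  then show thesis
    using that(1)[of k] that(2)[of k] k assms by (cases "t = real k"; cases "k = L") auto
qed

lemma path_point_realization:
  assumes "0 \<le> t" "t \<le> real L"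
  shows "path_point L w t \<in> realization V E"
proof -
  have nonneg: "0 \<le> path_point L w t x" for x
    unfolding path_point_def by (intro sum_nonneg) auto
  show ?thesis
    using assms
  proof (cases rule: unit_interval_cases)
    case (1 k)
    then show ?thesis
      using nonneg geodesic_V[of k]
      by (auto simp: realization_def supp_path_point near_of_nat path_point_at)
  next
    case (2 k)
    moreover have "w k \<noteq> w (Suc k)" using geodesic_inj 2 by simp
    ultimately show ?thesis
      using nonneg geodesic_E[of k]
      by (auto simp: realization_def supp_path_point near_between path_point_at)
  qed
qed

text \<open>
  If \<open>s\<close> and \<open>t\<close> lie in a common unit interval, both points lie on one edge. Otherwise the supports
  contain two vertices at distance at least 2, so they are in no common edge, and the minimum in
  \<open>realization_dist\<close> is attained by leaving through the next vertex after \<open>s\<close> and entering through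
  the last vertex before \<open>t\<close>. An isolated path (\<open>L = 0\<close>) is separate because it need not lie on any
  edge.
\<close>
lemma realization_dist_path_point_le:
  assumes st: "0 \<le> s" "s \<le> t" "t \<le> real L"
  shows "realization_dist E (path_point L w s) (path_point L w t) = t - s"
proof -
  let ?a = "path_point L w s" and ?b = "path_point L w t"
  consider (zero) "L = 0" | (near) k where "k < L" "real k \<le> s" "t \<le> real k + 1"
    | (far) "L \<noteq> 0" "\<And>k. k < L \<Longrightarrow> real k \<le> s \<Longrightarrow> real k + 1 < t"
    by (meson not_le)
  then show ?thesis
  proof cases
    case zero
    then have "s = 0" "t = 0" using st by auto
    moreover have "supp (path_point L w 0) = {w 0}"
      using supp_path_point[of 0] near_of_nat[of 0] by simp
    ultimately show ?thesis
      using path_point_at[of 0 0] graph_dist_refl[of "w 0"] by (auto simp: realization_dist_def)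
  next
    case near
    have sub: "near s \<subseteq> {k, Suc k}" "near t \<subseteq> {k, Suc k}"
      using near st by (auto simp: near_def)
    have "\<exists>e\<in>E. supp ?a \<union> supp ?b \<subseteq> e"
      by (rule bexI[OF _ geodesic_E[OF near(1)]]) (use sub in \<open>auto simp: supp_path_point\<close>)
    moreover have "{\<bar>?a v - ?b v\<bar> | v. v \<in> supp ?a \<union> supp ?b} = {t - s}"
    proof -
      have "\<bar>?a v - ?b v\<bar> = t - s" if "v \<in> supp ?a \<union> supp ?b" for v
        using that sub near st by (auto simp: supp_path_point path_point_at)
      moreover have "near s \<noteq> {}"
      proof -
        have "k \<in> near s \<or> Suc k \<in> near s" using near st by (auto simp: near_def)
        then show ?thesis by auto
      qed
      then have "supp ?a \<noteq> {}" by (simp add: supp_path_point)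
      ultimately have "(\<lambda>v. \<bar>?a v - ?b v\<bar>) ` (supp ?a \<union> supp ?b) = {t - s}"
        by (auto simp: image_iff)
      then show ?thesis by (simp only: setcompr_eq_image Collect_mem_eq)
    qed
    ultimately show ?thesis by (simp add: realization_dist_def)
  next
    case far
    \<comment> \<open>The outermost vertices \<open>k \<le> s\<close> and \<open>j \<ge> t\<close> of the two supports are at distance \<open>j - k \<ge> 2\<close>.\<close>
    define k where "k = nat \<lfloor>s\<rfloor>"
    have k: "real k \<le> s" "s < real k + 1" using st by (auto simp: k_def)
    have kL: "k < L"
    proof (rule ccontr)
      assume "\<not> k < L"
      then have "real L \<le> s" using k by linarith
      then show False using far(2)[of "L - 1"] far(1) st by (auto simp: of_nat_diff)
    qed
    have kt: "real k + 1 < t" using far kL k by simp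
    define j where "j = nat \<lceil>t\<rceil>"
    have j: "t \<le> real j" "real j < t + 1" using st by (auto simp: j_def) linarith+
    then have jL: "j \<le> L" using st by linarith
    have jk: "k + 2 \<le> j" using j kt by linarith
    have in_near: "k \<in> near s" "j \<in> near t" using k j kL jL by (auto simp: near_def)
    have "\<not> (\<exists>e\<in>E. supp ?a \<union> supp ?b \<subseteq> e)"
    proof
      assume "\<exists>e\<in>E. supp ?a \<union> supp ?b \<subseteq> e"
      then obtain e where "e \<in> E" "w k \<in> e" "w j \<in> e"
        using in_near by (auto simp: supp_path_point)
      then have "d (w k) (w j) \<le> 1" by (rule graph_dist_edge)
      moreover have "real (d (w k) (w j)) = \<bar>real k - real j\<bar>"
        using geo kL jL by (simp add: geodesic_def)
      ultimately show False using jk by linarith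
    qed
    moreover have "Min {(1 - ?a u) + real (graph_dist E u v) + (1 - ?b v) | u v.
        u \<in> supp ?a \<and> v \<in> supp ?b} = t - s"
    proof (rule Min_eqI)
      have fin: "finite (near r)" for r by (auto simp: near_def)
      have eq: "{(1 - ?a u) + real (graph_dist E u v) + (1 - ?b v) | u v. u \<in> supp ?a \<and> v \<in> supp ?b} =
          (\<lambda>(u, v). (1 - ?a u) + real (graph_dist E u v) + (1 - ?b v)) ` (supp ?a \<times> supp ?b)"
        by auto
      show "finite {(1 - ?a u) + real (graph_dist E u v) + (1 - ?b v) | u v.
          u \<in> supp ?a \<and> v \<in> supp ?b}"
        unfolding eq using fin by (simp add: supp_path_point)
      have val: "(1 - ?a (w i)) + real (graph_dist E (w i) (w l)) + (1 - ?b (w l)) =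
          \<bar>s - real i\<bar> + \<bar>real i - real l\<bar> + \<bar>t - real l\<bar>" if "i \<in> near s" "l \<in> near t" for i l
        using that geo by (auto simp: near_def path_point_at geodesic_def)
      show "t - s \<le> y" if y: "y \<in> {(1 - ?a u) + real (graph_dist E u v) + (1 - ?b v) | u v.
          u \<in> supp ?a \<and> v \<in> supp ?b}" for y
      proof -
        obtain i l where "i \<in> near s" "l \<in> near t"
          "y = (1 - ?a (w i)) + real (graph_dist E (w i) (w l)) + (1 - ?b (w l))"
          using y by (fastforce simp: supp_path_point)
        then show ?thesis using val by simp
      qed
      define i where "i = nat \<lceil>s\<rceil>"
      define l where "l = nat \<lfloor>t\<rfloor>"
      have i: "s \<le> real i" "real i < s + 1" using st by (auto simp: i_def) linarith+
      have l: "real l \<le> t" "t < real l + 1" using st by (auto simp: l_def)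
      have "i \<le> k + 1" "k + 1 \<le> l" using i l k kt by linarith+
      then have il: "real i \<le> real l" by simp
      have "i \<in> near s" "l \<in> near t"
        using i l st il by (auto simp: near_def)
      moreover from this have "t - s = (1 - ?a (w i)) + real (graph_dist E (w i) (w l)) + (1 - ?b (w l))"
        using val i l il by simp
      ultimately show "t - s \<in> {(1 - ?a u) + real (graph_dist E u v) + (1 - ?b v) | u v.
          u \<in> supp ?a \<and> v \<in> supp ?b}"
        unfolding supp_path_point by blast
    qed
    ultimately show ?thesis unfolding realization_dist_def by (simp only: if_False)
  qed
qed

lemma realization_dist_path_point:
  assumes "0 \<le> s" "s \<le> real L" "0 \<le> t" "t \<le> real L"
  shows "realization_dist E (path_point L w s) (path_point L w t) = \<bar>s - t\<bar>"
proof (cases "s \<le> t")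
  case True
  then show ?thesis using realization_dist_path_point_le[of s t] assms by simp
next
  case False
  have "supp (path_point L w r) \<subseteq> V" for r
    using geodesic_V by (auto simp: supp_path_point near_def)
  then show ?thesis
    using False realization_dist_path_point_le[of t s] assms realization_dist_sym by simp
qed

lemma geodesic_segment_path_point:
  "geodesic_segment (realization V E) (realization_dist E)
    (path_point L w 0) (path_point L w (real L)) (path_point L w ` {0..real L})"
  unfolding geodesic_segment_def
proof (intro exI[of _ "real L"] conjI exI[of _ "path_point L w"])
  show "path_point L w ` {0..real L} \<subseteq> realization V E"
    using path_point_realization by auto
qed (auto simp: realization_dist_path_point)

lemma path_point_of_nat: "k \<le> L \<Longrightarrow> path_point L w (real k) = (\<lambda>_. 0)(w k := 1)"
proof
  fix x assume k: "k \<le> L"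
  show "path_point L w (real k) x = ((\<lambda>_. 0)(w k := 1)) x"
  proof (cases "x \<in> w ` {..L}")
    case True
    then obtain i where "i \<le> L" "x = w i" by auto
    then show ?thesis using k geodesic_inj path_point_at[of i "real k"] by auto
  next
    case False
    then show ?thesis using k path_point_off by auto
  qed
qed

text \<open>
  Passing from a point of the realization to a vertex costs at most 1. This turns the hypothesis about
  geodesic segments into a statement about the combinatorial distance alone.
\<close>
lemma close_vertex:
  assumes t: "0 \<le> t" "t \<le> real L" and x: "x \<in> V"
    and dist: "realization_dist E ((\<lambda>_. 0)(x := 1)) (path_point L w t) \<le> \<delta>" and "0 \<le> \<delta>"
  shows "\<exists>i\<le>L. real (d x (w i)) \<le> \<delta> + 1"
proof -
  let ?a = "(\<lambda>_. 0 :: real)(x := 1)" and ?b = "path_point L w t"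
  have sa: "supp ?a = {x}" by (auto simp: supp_def)
  have ne: "near t \<noteq> {}"
    using t by (cases rule: unit_interval_cases) (auto simp: near_of_nat near_between)
  show ?thesis
  proof (cases "\<exists>e\<in>E. supp ?a \<union> supp ?b \<subseteq> e")
    case True
    then obtain e i where "e \<in> E" "x \<in> e" "i \<in> near t" "w i \<in> e"
      using ne by (auto simp: sa supp_path_point)
    then have "d x (w i) \<le> 1" "i \<le> L" using graph_dist_edge by (auto simp: near_def)
    then show ?thesis using \<open>0 \<le> \<delta>\<close> by (intro exI[of _ i]) auto
  next
    case False
    let ?M = "{(1 - ?a u) + real (graph_dist E u v) + (1 - ?b v) | u v. u \<in> supp ?a \<and> v \<in> supp ?b}"
    have M: "?M = (\<lambda>i. real (d x (w i)) + (1 - ?b (w i))) ` near t"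
      by (auto simp: sa supp_path_point)
    have "finite ?M" unfolding M by (intro finite_imageI) (auto simp: near_def)
    moreover have "?M \<noteq> {}" unfolding M using ne by simp
    ultimately have "Min ?M \<in> ?M" by (rule Min_in)
    then obtain i where i: "i \<in> near t" "Min ?M = real (d x (w i)) + (1 - ?b (w i))"
      unfolding M by auto
    have "realization_dist E ?a ?b = Min ?M"
      unfolding realization_dist_def using False by (rule if_not_P)
    then have "Min ?M \<le> \<delta>" using dist by simp
    moreover have "?b (w i) \<le> 1" using i by (simp add: near_def path_point_at)
    ultimately show ?thesis using i \<open>0 \<le> \<delta>\<close> by (intro exI[of _ i]) (auto simp: near_def)
  qed
qed

end

lemma slim_triangle_vertices:
  assumes hyp: "delta_hyperbolic (realization V E) (realization_dist E) \<delta>" and \<delta>: "0 \<le> \<delta>"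
    and geo: "geodesic x y L1 w1" "geodesic y z L2 w2" "geodesic z x L3 w3" and i: "i \<le> L1"
  shows "(\<exists>j\<le>L2. real (d (w1 i) (w2 j)) \<le> \<delta> + 1) \<or> (\<exists>j\<le>L3. real (d (w1 i) (w3 j)) \<le> \<delta> + 1)"
proof -
  have ends: "w1 0 = x" "w1 L1 = y" "w2 0 = y" "w2 L2 = z" "w3 0 = z" "w3 L3 = x"
    using geo by (auto simp: geodesic_def path_between_def)
  let ?v = "\<lambda>x. (\<lambda>_. 0 :: real)(x := 1)"
  have pts: "path_point L1 w1 0 = ?v x" "path_point L1 w1 (real L1) = ?v y"
    "path_point L2 w2 0 = ?v y" "path_point L2 w2 (real L2) = ?v z"
    "path_point L3 w3 0 = ?v z" "path_point L3 w3 (real L3) = ?v x"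
    using path_point_of_nat[OF geo(1), of 0] path_point_of_nat[OF geo(1), of L1]
      path_point_of_nat[OF geo(2), of 0] path_point_of_nat[OF geo(2), of L2]
      path_point_of_nat[OF geo(3), of 0] path_point_of_nat[OF geo(3), of L3]
    by (simp_all add: ends)
  have segs: "geodesic_segment (realization V E) (realization_dist E) (?v x) (?v y) (path_point L1 w1 ` {0..real L1})"
    "geodesic_segment (realization V E) (realization_dist E) (?v y) (?v z) (path_point L2 w2 ` {0..real L2})"
    "geodesic_segment (realization V E) (realization_dist E) (?v z) (?v x) (path_point L3 w3 ` {0..real L3})"
    using geodesic_segment_path_point[OF geo(1)] geodesic_segment_path_point[OF geo(2)]
      geodesic_segment_path_point[OF geo(3)] by (simp_all only: pts)
  have "path_point L1 w1 (real i) \<in> path_point L1 w1 ` {0..real L1}" using i by auto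
  then have on1: "?v (w1 i) \<in> path_point L1 w1 ` {0..real L1}"
    using path_point_of_nat[OF geo(1) i] by simp
  obtain b where b: "b \<in> path_point L2 w2 ` {0..real L2} \<union> path_point L3 w3 ` {0..real L3}"
    "realization_dist E (?v (w1 i)) b \<le> \<delta>"
    using hyp[unfolded delta_hyperbolic_def, rule_format, OF segs on1] by blast
  have "w1 i \<in> V" using geodesic_V[OF geo(1) i] .
  from b(1) consider (yz) t where "0 \<le> t" "t \<le> real L2" "b = path_point L2 w2 t"
    | (zx) t where "0 \<le> t" "t \<le> real L3" "b = path_point L3 w3 t" by auto
  then show ?thesis
  proof cases
    case yz
    then show ?thesis
      using close_vertex[OF geo(2) yz(1,2) \<open>w1 i \<in> V\<close> _ \<delta>] b(2) by simp
  next
    case zx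
    then show ?thesis
      using close_vertex[OF geo(3) zx(1,2) \<open>w1 i \<in> V\<close> _ \<delta>] b(2) by simp
  qed
qed

lemma geodesic_split:
  assumes "geodesic x y L w" "i \<le> L"
  shows "d x (w i) + d (w i) y = d x y"
proof -
  have "w 0 = x" "w L = y" using assms by (auto simp: geodesic_def path_between_def)
  then have "real (d x (w i)) = real i" "real (d (w i) y) = real L - real i" "real (d x y) = real L"
    using assms by (auto simp: geodesic_def)
  then show ?thesis by linarith
qed

text \<open>
  Walking along the side from \<open>x\<close> to \<open>z\<close>, the vertices are first close to the side from \<open>x\<close> to \<open>y\<close>
  and in the end close to the side from \<open>y\<close> to \<open>z\<close>. Where this changes, a vertex is close to both, hence
  nearly on a geodesic from \<open>x\<close> to \<open>y\<close> and nearly on one from \<open>z\<close> to \<open>y\<close>.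
\<close>
lemma slim_center:
  fixes \<delta> :: real
  assumes hyp: "delta_hyperbolic (realization V E) (realization_dist E) \<delta>" and \<delta>: "0 \<le> \<delta>"
    and V: "x \<in> V" "y \<in> V" "z \<in> V" and geo: "geodesic x z L w"
  obtains i where "i \<le> L" "d x (w i) + d (w i) y \<le> d x y + 2 * (\<delta> + 2)"
    "d z (w i) + d (w i) y \<le> d z y + 2 * (\<delta> + 2)"
proof -
  obtain w2 where w2: "geodesic z y (d z y) w2" using geodesic_exists V by blast
  obtain w3 where w3: "geodesic y x (d y x) w3" using geodesic_exists V by blast
  have wV: "w i \<in> V" if "i \<le> L" for i using geodesic_V[OF geo that] .
  define P where "P i \<longleftrightarrow> (\<exists>j\<le>d y x. real (d (w i) (w3 j)) \<le> \<delta> + 1)" for i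
  define Q where "Q i \<longleftrightarrow> (\<exists>j\<le>d z y. real (d (w i) (w2 j)) \<le> \<delta> + 1)" for i
  have PQ: "P i \<or> Q i" if "i \<le> L" for i
    using slim_triangle_vertices[OF hyp \<delta> geo w2 w3 that] by (auto simp: P_def Q_def)
  have ends: "w 0 = x" "w L = z" "w2 0 = z" "w3 (d y x) = x"
    using geo w2 w3 by (auto simp: geodesic_def path_between_def)
  have "P 0" unfolding P_def using ends \<delta> graph_dist_refl[of x] by (intro exI[of _ "d y x"]) auto
  have "Q L" unfolding Q_def using ends \<delta> graph_dist_refl[of z] by (intro exI[of _ 0]) auto
  have bnd: "d u (w i) + d (w i) v \<le> d u v + 2 * (\<delta> + 2)"
    if "q \<in> V" "u \<in> V" "v \<in> V" "i \<le> L" "d u q + d q v = d u v" "real (d (w i) q) \<le> \<delta> + 2" for u v q i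
    using graph_dist_triangle[of u q "w i"] graph_dist_triangle[of "w i" q v] graph_dist_sym[of q "w i"]
      that wV[of i] by auto
  have Pb: "d x (w i) + d (w i) y \<le> d x y + 2 * (\<delta> + 2)" if i: "i \<le> L" "P i" for i
  proof -
    obtain j where j: "j \<le> d y x" "real (d (w i) (w3 j)) \<le> \<delta> + 1" using i by (auto simp: P_def)
    have "w3 j \<in> V" using geodesic_V[OF w3 j(1)] .
    moreover from this have "d x (w3 j) + d (w3 j) y = d x y"
      using geodesic_split[OF w3 j(1)] graph_dist_sym V by simp
    ultimately show ?thesis using bnd[of "w3 j" x y i] j i V by simp
  qed
  have Qb: "d z (w i) + d (w i) y \<le> d z y + 2 * (\<delta> + 2)"
    if i: "i \<le> L" "k \<le> L" "Q k" "real (d (w i) (w k)) \<le> 1" for i k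
  proof -
    obtain j where j: "j \<le> d z y" "real (d (w k) (w2 j)) \<le> \<delta> + 1" using i by (auto simp: Q_def)
    have V2: "w2 j \<in> V" using geodesic_V[OF w2 j(1)] .
    moreover have "d z (w2 j) + d (w2 j) y = d z y"
      using geodesic_split[OF w2 j(1)] .
    moreover have "real (d (w i) (w2 j)) \<le> \<delta> + 2"
      using graph_dist_triangle[of "w i" "w k" "w2 j"] wV i V2 j by auto
    ultimately show ?thesis using bnd[of "w2 j" z y i] i V by simp
  qed
  \<comment> \<open>The predecessor of the first vertex that is close to the side of \<open>z\<close>, or this vertex itself
    if it is \<open>x\<close>, is close to both sides.\<close>
  define i where "i = (LEAST i. Q i)"
  have i: "Q i" "i \<le> L" using \<open>Q L\<close> unfolding i_def by (auto intro: LeastI Least_le)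
  show thesis
  proof (cases i)
    case 0
    then show ?thesis
      using that[of 0] Pb[of 0] Qb[of 0 0] \<open>P 0\<close> i graph_dist_refl[of "w 0"] by simp
  next
    case (Suc k)
    then have "\<not> Q k" unfolding i_def using not_less_Least by (metis lessI)
    then have "P k" using PQ[of k] Suc i by auto
    moreover have "real (d (w k) (w i)) = \<bar>real k - real i\<bar>"
      using geo Suc i by (simp add: geodesic_def)
    ultimately show ?thesis
      using that[of k] Pb[of k] Qb[of k i] i Suc by simp
  qed
qed

text \<open>
  On one geodesic from \<open>x\<close> to \<open>z\<close> there is a vertex \<open>w i\<close> nearly between \<open>x\<close>, \<open>y\<close> and between \<open>z\<close>, \<open>y\<close>,
  and a vertex \<open>w j\<close> with the same property for \<open>t\<close>. The path from \<open>y\<close> over \<open>w i\<close> and \<open>w j\<close> to \<open>t\<close>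
  bounds \<open>d y t\<close>. Together with the geodesic it is cut into paths from \<open>x\<close> to \<open>t\<close> and from \<open>y\<close> to \<open>z\<close>,
  or from \<open>x\<close> to \<open>y\<close> and from \<open>z\<close> to \<open>t\<close>, according to the order of \<open>i\<close> and \<open>j\<close>.
\<close>
lemma four_point:
  fixes \<delta> :: real
  assumes hyp: "delta_hyperbolic (realization V E) (realization_dist E) \<delta>" and \<delta>: "0 \<le> \<delta>"
    and V: "x \<in> V" "y \<in> V" "z \<in> V" "t \<in> V"
  shows "d x z + d y t \<le> max (real (d x y + d z t)) (real (d x t + d y z)) + 4 * (\<delta> + 2)"
proof -
  obtain w where w: "geodesic x z (d x z) w" using geodesic_exists V by blast
  obtain i where i: "i \<le> d x z" "d x (w i) + d (w i) y \<le> d x y + 2 * (\<delta> + 2)"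
    "d z (w i) + d (w i) y \<le> d z y + 2 * (\<delta> + 2)"
    using slim_center[OF hyp \<delta> V(1,2,3) w] .
  obtain j where j: "j \<le> d x z" "d x (w j) + d (w j) t \<le> d x t + 2 * (\<delta> + 2)"
    "d z (w j) + d (w j) t \<le> d z t + 2 * (\<delta> + 2)"
    using slim_center[OF hyp \<delta> V(1,4,3) w] .
  have wV: "w i \<in> V" "w j \<in> V" using geodesic_V[OF w] i j by auto
  have ends: "w 0 = x" "w (d x z) = z" using w by (auto simp: geodesic_def path_between_def)
  have along: "real (d (w a) (w b)) = \<bar>real a - real b\<bar>" if "a \<le> d x z" "b \<le> d x z" for a b
    using w that by (simp add: geodesic_def)
  have dists: "real (d x (w k)) = real k" "real (d z (w k)) = real (d x z) - real k" if "k \<le> d x z" for k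
  proof -
    show "real (d x (w k)) = real k" "real (d z (w k)) = real (d x z) - real k"
      using along[of 0 k] along[of "d x z" k] that ends by simp_all
  qed
  have between: "real (d (w i) (w j)) = \<bar>real i - real j\<bar>"
    using along i j by simp
  have "d y t \<le> d (w i) y + d (w i) (w j) + d (w j) t"
    using graph_dist_triangle[of y "w i" t] graph_dist_triangle[of "w i" "w j" t]
      graph_dist_sym[of y "w i"] V wV by simp
  then have yt: "real (d y t) \<le> real (d (w i) y) + real (d (w i) (w j)) + real (d (w j) t)" by linarith
  have zy: "real (d z y) = real (d y z)" using graph_dist_sym V by simp
  note bounds = i(2,3) j(2,3) dists[OF i(1)] dists[OF j(1)]
  show ?thesis
  proof (cases "i \<le> j")
    case True
    then have "real (d (w i) (w j)) = real j - real i" using between by simp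
    then have "real (d x z) + real (d y t) \<le> real (d x t) + real (d y z) + 4 * (\<delta> + 2)"
      using bounds yt zy by linarith
    then show ?thesis by simp
  next
    case False
    then have "real (d (w i) (w j)) = real i - real j" using between by simp
    then have "real (d x z) + real (d y t) \<le> real (d x y) + real (d z t) + 4 * (\<delta> + 2)"
      using bounds yt zy by linarith
    then show ?thesis by simp
  qed
qed

end

section \<open>Hyperbolic groups have no undistorted flats\<close>

text \<open>
  The infimum \<open>\<tau>\<close> of \<open>F k / k\<close> is the stable length. If \<open>k\<close> nearly attains it, then by subadditivity
  so do all multiples of \<open>k\<close>, with the same relative error.
\<close>
lemma stable_length:
  fixes F :: "nat \<Rightarrow> real"
  assumes sub: "\<And>i j. F (i + j) \<le> F i + F j" and zero: "F 0 \<le> 0"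
    and lower: "\<And>i. c * real i \<le> F i" and c: "0 < c"
  obtains \<tau> where "c \<le> \<tau>" "\<And>i. \<tau> * real i \<le> F i"
    "\<And>\<epsilon>. 0 < \<epsilon> \<Longrightarrow> \<exists>k>0. \<forall>j. F (j * k) \<le> (1 + \<epsilon>) * \<tau> * real (j * k)"
proof -
  define R where "R = (\<lambda>k. F k / real k) ` {0<..}"
  define \<tau> where "\<tau> = Inf R"
  have ge: "c \<le> r" if "r \<in> R" for r
    using that lower by (auto simp: R_def field_simps)
  have ne: "R \<noteq> {}" by (auto simp: R_def)
  have bdd: "bdd_below R" using ge by (rule bdd_belowI)
  have \<tau>c: "c \<le> \<tau>" unfolding \<tau>_def using ne ge by (intro cInf_greatest)
  have low: "\<tau> * real i \<le> F i" for i
  proof (cases "i = 0")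
    case True
    then show ?thesis using lower[of 0] by simp
  next
    case False
    then have "F i / real i \<in> R" by (auto simp: R_def)
    then have "\<tau> \<le> F i / real i" unfolding \<tau>_def using bdd by (rule cInf_lower)
    then show ?thesis using False by (simp add: field_simps)
  qed
  have mult: "F (j * k) \<le> real j * F k" for j k
  proof (induction j)
    case (Suc j)
    then show ?case using sub[of k "j * k"] by (simp add: algebra_simps)
  qed (use zero in simp)
  have "\<exists>k>0. \<forall>j. F (j * k) \<le> (1 + \<epsilon>) * \<tau> * real (j * k)" if \<epsilon>: "0 < \<epsilon>" for \<epsilon>
  proof -
    have "Inf R < (1 + \<epsilon>) * \<tau>"
      using \<epsilon> \<tau>c c by (simp add: \<tau>_def[symmetric] algebra_simps)
    then obtain r where "r \<in> R" "r < (1 + \<epsilon>) * \<tau>"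
      using ne bdd by (auto simp: cInf_less_iff)
    then obtain k where k: "0 < k" "F k < (1 + \<epsilon>) * \<tau> * real k"
      by (auto simp: R_def field_simps)
    have "F (j * k) \<le> (1 + \<epsilon>) * \<tau> * real (j * k)" for j
    proof -
      have "F (j * k) \<le> real j * F k" by (rule mult)
      also have "\<dots> \<le> real j * ((1 + \<epsilon>) * \<tau> * real k)"
        using k by (intro mult_left_mono) auto
      finally show ?thesis by (simp add: algebra_simps)
    qed
    then show ?thesis using k by blast
  qed
  then show thesis using that \<tau>c low by blast
qed

text \<open>
  The arithmetic of the contradiction: \<open>F m\<close> and \<open>H l\<close> are the lengths of \<open>u = g\<^sup>m\<close> and \<open>v = h\<^sup>l\<close>, and
  \<open>P, Q\<close> those of \<open>u v\<close> and \<open>u v\<^sup>-\<^sup>1\<close>. Since \<open>P\<close> and \<open>Q\<close> are both at least \<open>c m\<close>, their maximum falls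
  short of their sum by this amount, and a linear gain is left over when the two inequalities of \<open>four\<close>
  are chained.
\<close>
lemma no_flat_lengths:
  fixes F H :: "nat \<Rightarrow> real"
  assumes F: "\<And>i j. F (i + j) \<le> F i + F j" "F 0 \<le> 0" "\<And>i. c * real i \<le> F i"
    and H: "\<And>i j. H (i + j) \<le> H i + H j" "H 0 \<le> 0" "\<And>i. c * real i \<le> H i"
    and c: "0 < c"
    and four: "\<And>m l. \<exists>P Q. c * real m \<le> P \<and> c * real m \<le> Q \<and>
      P + Q \<le> 2 * max (F m) (H l) + D \<and> F (2 * m) + H (2 * l) \<le> 2 * max P Q + D"
  shows False
proof -
  obtain \<tau> where \<tau>: "c \<le> \<tau>" "\<And>i. \<tau> * real i \<le> F i"
    "\<And>\<epsilon>. 0 < \<epsilon> \<Longrightarrow> \<exists>k>0. \<forall>j. F (j * k) \<le> (1 + \<epsilon>) * \<tau> * real (j * k)"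
    using stable_length[of F c] F c by blast
  obtain \<sigma> where \<sigma>: "c \<le> \<sigma>" "\<And>i. \<sigma> * real i \<le> H i"
    "\<And>\<epsilon>. 0 < \<epsilon> \<Longrightarrow> \<exists>k>0. \<forall>j. H (j * k) \<le> (1 + \<epsilon>) * \<sigma> * real (j * k)"
    using stable_length[of H c] H c by blast
  \<comment> \<open>The relative error \<open>\<epsilon>\<close> costs \<open>4 \<epsilon> \<tau> m = c m\<close>, half of the gain \<open>2 c m\<close>.\<close>
  define \<epsilon> where "\<epsilon> = c / (4 * \<tau>)"
  have \<epsilon>: "0 < \<epsilon>" "4 * \<epsilon> * \<tau> = c" using c \<tau>(1) by (auto simp: \<epsilon>_def)
  obtain k where k: "0 < k" "\<And>j. F (j * k) \<le> (1 + \<epsilon>) * \<tau> * real (j * k)"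
    using \<tau>(3)[OF \<epsilon>(1)] by blast
  obtain q where q: "0 < q" "\<And>j. H (j * q) \<le> (1 + \<epsilon>) * \<sigma> * real (j * q)"
    using \<sigma>(3)[OF \<epsilon>(1)] by blast
  have bound: "c * real j \<le> 3 * D + 2 * \<sigma> * real q" for j
  proof -
    define m where "m = j * k"
    \<comment> \<open>The multiple \<open>l\<close> of \<open>q\<close> is chosen so that \<open>g\<^sup>m\<close> and \<open>h\<^sup>l\<close> have the same stable length up to a constant.\<close>
    define i where "i = nat \<lfloor>\<tau> * real m / (\<sigma> * real q)\<rfloor>"
    define l where "l = i * q"
    have pos: "0 < \<sigma> * real q" using \<sigma>(1) c q(1) by simp
    have "0 \<le> \<tau> * real m / (\<sigma> * real q)" using pos \<tau>(1) c by simp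
    then have "real i \<le> \<tau> * real m / (\<sigma> * real q)" "\<tau> * real m / (\<sigma> * real q) < real i + 1"
      unfolding i_def by linarith+
    then have l: "\<sigma> * real l \<le> \<tau> * real m" "\<tau> * real m \<le> \<sigma> * real l + \<sigma> * real q"
      using pos by (simp_all add: l_def field_simps)
    have Fm: "F m \<le> (1 + \<epsilon>) * (\<tau> * real m)" using k(2)[of j] by (simp add: m_def mult.assoc)
    have "H l \<le> (1 + \<epsilon>) * (\<sigma> * real l)" using q(2)[of i] by (simp add: l_def mult.assoc)
    also have "\<dots> \<le> (1 + \<epsilon>) * (\<tau> * real m)" using l \<epsilon> by (intro mult_left_mono) auto
    finally have Hl: "H l \<le> (1 + \<epsilon>) * (\<tau> * real m)" .
    obtain P Q where PQ: "c * real m \<le> P" "c * real m \<le> Q" "P + Q \<le> 2 * max (F m) (H l) + D"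
      "F (2 * m) + H (2 * l) \<le> 2 * max P Q + D"
      using four by blast
    have "2 * (\<tau> * real m) \<le> F (2 * m)" "2 * (\<sigma> * real l) \<le> H (2 * l)"
      using \<tau>(2)[of "2 * m"] \<sigma>(2)[of "2 * l"] by simp_all
    moreover have "max (F m) (H l) \<le> (1 + \<epsilon>) * (\<tau> * real m)" using Fm Hl by simp
    moreover have "4 * ((1 + \<epsilon>) * (\<tau> * real m)) = 4 * (\<tau> * real m) + c * real m"
      unfolding \<epsilon>(2)[symmetric] by (simp add: algebra_simps)
    moreover have "max P Q \<le> P + Q - c * real m" using PQ by auto
    ultimately have "c * real m \<le> 3 * D + 2 * \<sigma> * real q"
      using PQ l(2) by linarith
    moreover have "j \<le> m" using k(1) by (simp add: m_def)
    then have "c * real j \<le> c * real m" using c by simp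
    ultimately show ?thesis by linarith
  qed
  obtain j where "(3 * D + 2 * \<sigma> * real q) / c < real j" using reals_Archimedean2 by blast
  then show False using bound[of j] c by (simp add: field_simps)
qed

lemma cayley_edges_translate:
  assumes "group G" "S \<subseteq> carrier G" "a \<in> carrier G" "x \<in> carrier G" "y \<in> carrier G"
    and "{x, y} \<in> cayley_edges G S"
  shows "{a \<otimes>\<^bsub>G\<^esub> x, a \<otimes>\<^bsub>G\<^esub> y} \<in> cayley_edges G S"
proof -
  interpret group G by fact
  obtain g s where gs: "{x, y} = {g, g \<otimes>\<^bsub>G\<^esub> s}" "g \<in> carrier G" "s \<in> S" "g \<otimes>\<^bsub>G\<^esub> s \<noteq> g"
    using assms(6) by (auto simp: cayley_edges_def)
  have s: "s \<in> carrier G" using gs assms(2) by auto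
  have "{a \<otimes>\<^bsub>G\<^esub> x, a \<otimes>\<^bsub>G\<^esub> y} = (\<lambda>z. a \<otimes>\<^bsub>G\<^esub> z) ` {x, y}" by simp
  also have "\<dots> = {a \<otimes>\<^bsub>G\<^esub> g, a \<otimes>\<^bsub>G\<^esub> g \<otimes>\<^bsub>G\<^esub> s}"
    unfolding gs(1) using gs assms s by (simp add: m_assoc)
  also have "\<dots> \<in> cayley_edges G S"
  proof -
    have "a \<otimes>\<^bsub>G\<^esub> g \<otimes>\<^bsub>G\<^esub> s \<noteq> a \<otimes>\<^bsub>G\<^esub> g"
      using gs assms s by (simp add: m_assoc)
    then show ?thesis using gs assms(3) unfolding cayley_edges_def by blast
  qed
  finally show ?thesis .
qed

locale cayley = group G for G (structure) +
  fixes S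
  assumes S_carrier: "S \<subseteq> carrier G" and S_generates: "generate G S = carrier G"
begin

abbreviation "E \<equiv> cayley_edges G S"

lemma cayley_edge_ends:
  assumes "e \<in> E" shows "\<exists>u\<in>carrier G. \<exists>v\<in>carrier G. u \<noteq> v \<and> e = {u, v}"
proof -
  obtain g s where gs: "e = {g, g \<otimes> s}" "g \<in> carrier G" "s \<in> S" "g \<otimes> s \<noteq> g"
    using assms by (auto simp: cayley_edges_def)
  then show ?thesis using S_carrier by (intro bexI[of _ g] bexI[of _ "g \<otimes> s"]) auto
qed

lemma path_in_carrier:
  assumes "path_between E u v k w" "u \<in> carrier G" "i \<le> k"
  shows "w i \<in> carrier G"
proof (cases i)
  case 0
  then show ?thesis using assms by (simp add: path_between_def)
next
  case (Suc j)
  then have "{w j, w (Suc j)} \<in> E" using assms by (auto simp: path_between_def)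
  from cayley_edge_ends[OF this] show ?thesis using Suc by (auto simp: doubleton_eq_iff)
qed

lemma path_translate:
  assumes "path_between E u v k w" "u \<in> carrier G" "a \<in> carrier G"
  shows "path_between E (a \<otimes> u) (a \<otimes> v) k (\<lambda>i. a \<otimes> w i)"
  using assms cayley_edges_translate[OF is_group S_carrier assms(3)] path_in_carrier[OF assms(1,2)]
  by (auto simp: path_between_def)

lemma path_from_one:
  assumes "x \<in> generate G S" shows "\<exists>k w. path_between E \<one> x k w"
  using assms
proof (induction rule: generate.induct)
  case one
  have "path_between E \<one> \<one> 0 (\<lambda>_. \<one>)" by (simp add: path_between_def)
  then show ?case by blast
next
  case (incl h)
  show ?case
  proof (cases "h = \<one>")
    case True
    have "path_between E \<one> h 0 (\<lambda>_. \<one>)" using True by (simp add: path_between_def)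
    then show ?thesis by blast
  next
    case False
    have "\<one> \<otimes> h \<noteq> \<one>" using False incl S_carrier by auto
    then have "{\<one>, \<one> \<otimes> h} \<in> E" using incl unfolding cayley_edges_def by blast
    then have "path_between E \<one> h 1 (\<lambda>i. if i = 0 then \<one> else h)"
      using incl S_carrier by (auto simp: path_between_def)
    then show ?thesis by blast
  qed
next
  case (inv h)
  have h: "h \<in> carrier G" using inv S_carrier by auto
  show ?case
  proof (cases "h = \<one>")
    case True
    have "path_between E \<one> (inv h) 0 (\<lambda>_. \<one>)" using True by (simp add: path_between_def)
    then show ?thesis by blast
  next
    case False
    have "inv h \<otimes> h \<noteq> inv h" using False h by (metis l_inv inv_one inv_inv)
    then have "{inv h, inv h \<otimes> h} \<in> E" using inv h unfolding cayley_edges_def by blast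
    then have "path_between E \<one> (inv h) 1 (\<lambda>i. if i = 0 then \<one> else inv h)"
      using h by (auto simp: path_between_def insert_commute)
    then show ?thesis by blast
  qed
next
  case (eng x y)
  have xy: "x \<in> carrier G" "y \<in> carrier G" using eng S_generates by auto
  obtain k w l w' where "path_between E \<one> x k w" "path_between E \<one> y l w'"
    using eng by blast
  then show ?case
    using path_between_append[of E \<one> x k w "x \<otimes> y" l] path_translate[of \<one> y l w' x] xy by fastforce
qed

sublocale connected_graph "carrier G" E
proof
  show "\<exists>u\<in>carrier G. \<exists>v\<in>carrier G. u \<noteq> v \<and> e = {u, v}" if "e \<in> E" for e
    using cayley_edge_ends[OF that] .
  show "\<exists>k w. path_between E u v k w" if uv: "u \<in> carrier G" "v \<in> carrier G" for u v
  proof -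
    obtain k w where "path_between E \<one> (inv u \<otimes> v) k w"
      using path_from_one[of "inv u \<otimes> v"] S_generates uv by auto
    then have "path_between E (u \<otimes> \<one>) (u \<otimes> (inv u \<otimes> v)) k (\<lambda>i. u \<otimes> w i)"
      using uv by (intro path_translate) auto
    moreover have "u \<otimes> (inv u \<otimes> v) = v" using uv by (simp add: m_assoc[symmetric])
    ultimately show ?thesis using uv by auto
  qed
qed

definition word_norm :: "'a \<Rightarrow> nat" where "word_norm x = d \<one> x"

lemma dist_translate:
  assumes "a \<in> carrier G" "x \<in> carrier G" "y \<in> carrier G"
  shows "d (a \<otimes> x) (a \<otimes> y) = d x y"
proof (rule antisym)
  have le: "d (a \<otimes> x) (a \<otimes> y) \<le> d x y"
    if a: "a \<in> carrier G" "x \<in> carrier G" "y \<in> carrier G" for a x y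
    using shortest_path[OF a(2,3)] path_translate[OF _ a(2,1)] graph_dist_le by metis
  show "d (a \<otimes> x) (a \<otimes> y) \<le> d x y" using le assms by blast
  have "d (inv a \<otimes> (a \<otimes> x)) (inv a \<otimes> (a \<otimes> y)) \<le> d (a \<otimes> x) (a \<otimes> y)"
    using assms by (intro le) auto
  then show "d x y \<le> d (a \<otimes> x) (a \<otimes> y)"
    using assms by (simp add: m_assoc[symmetric])
qed

lemma dist_eq_norm:
  assumes "x \<in> carrier G" "y \<in> carrier G"
  shows "d x y = word_norm (inv x \<otimes> y)"
  using dist_translate[of "inv x" x y] assms by (simp add: word_norm_def)

lemma norm_one: "word_norm \<one> = 0"
  by (simp add: word_norm_def graph_dist_refl)

lemma norm_mult:
  assumes "x \<in> carrier G" "y \<in> carrier G"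
  shows "word_norm (x \<otimes> y) \<le> word_norm x + word_norm y"
  using assms graph_dist_triangle[of \<one> x "x \<otimes> y"] dist_eq_norm[of x "x \<otimes> y"]
  by (simp add: word_norm_def m_assoc[symmetric])

text \<open>
  A length function grows by at most a constant along an edge of the Cayley graph. This makes the
  final argument independent of the generating set for which the group is assumed to be hyperbolic.
\<close>
lemma norm_lower_bound:
  fixes N :: "'a \<Rightarrow> nat"
  assumes fin: "finite S" and N1: "N \<one> = 0"
    and Nmult: "\<And>x y. x \<in> carrier G \<Longrightarrow> y \<in> carrier G \<Longrightarrow> N (x \<otimes> y) \<le> N x + N y"
    and Ninv: "\<And>x. x \<in> carrier G \<Longrightarrow> N (inv x) \<le> N x"
    and x: "x \<in> carrier G"
  shows "N x \<le> (\<Sum>s\<in>S. N s) * word_norm x"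
proof -
  let ?M = "\<Sum>s\<in>S. N s"
  obtain w where w: "path_between E \<one> x (word_norm x) w"
    using shortest_path[of \<one> x] x by (auto simp: word_norm_def)
  have step: "N v \<le> N u + ?M" if "{u, v} \<in> E" for u v
  proof -
    obtain g s where gs: "{u, v} = {g, g \<otimes> s}" "g \<in> carrier G" "s \<in> S"
      using \<open>{u, v} \<in> E\<close> by (auto simp: cayley_edges_def)
    have s: "s \<in> carrier G" using gs S_carrier by auto
    have M: "N s \<le> ?M" using fin gs by (intro member_le_sum) auto
    consider "u = g" "v = g \<otimes> s" | "v = g" "u = g \<otimes> s"
      using gs(1) by (auto simp: doubleton_eq_iff)
    then show ?thesis
    proof cases
      case 1
      then show ?thesis using Nmult[of g s] gs s M by simp
    next
      case 2
      then have "v = u \<otimes> inv s" using gs s by (simp add: m_assoc)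
      then show ?thesis using Nmult[of u "inv s"] Ninv[of s] 2 gs s M by simp
    qed
  qed
  have "i \<le> word_norm x \<Longrightarrow> N (w i) \<le> ?M * i" for i
  proof (induction i)
    case 0
    then show ?case using w N1 by (simp add: path_between_def)
  next
    case (Suc i)
    then have "N (w (Suc i)) \<le> N (w i) + ?M"
      using w by (intro step) (auto simp: path_between_def)
    then show ?case using Suc by simp
  qed
  from this[of "word_norm x"] show ?thesis using w by (simp add: path_between_def)
qed

text \<open>The four-point inequality for the parallelogram \<open>\<one>, u, u v, v\<close>, whose opposite sides have equal
  length because \<open>u\<close> and \<open>v\<close> commute.\<close>
lemma norm_parallelogram:
  fixes \<delta> :: real
  assumes hyp: "delta_hyperbolic (realization (carrier G) E) (realization_dist E) \<delta>" "0 \<le> \<delta>"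
    and uv: "u \<in> carrier G" "v \<in> carrier G" "u \<otimes> v = v \<otimes> u"
  shows "real (word_norm (u \<otimes> v)) + real (word_norm (u \<otimes> inv v)) \<le>
    2 * max (real (word_norm u)) (real (word_norm v)) + 4 * (\<delta> + 2)"
proof -
  have "d \<one> (u \<otimes> v) + d u v \<le> max (real (d \<one> u + d (u \<otimes> v) v)) (real (d \<one> v + d u (u \<otimes> v))) + 4 * (\<delta> + 2)"
    using four_point[OF hyp, of \<one> u "u \<otimes> v" v] uv by simp
  moreover have "d u v = word_norm (u \<otimes> inv v)"
  proof -
    have "inv v \<otimes> u = u \<otimes> inv v"
      using uv by (metis inv_closed inv_solve_left inv_solve_right m_assoc m_closed)
    then show ?thesis using dist_eq_norm[of v u] graph_dist_sym[of u v] uv by simp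
  qed
  moreover have "d (u \<otimes> v) v = word_norm u"
  proof -
    have "d (v \<otimes> u) (v \<otimes> \<one>) = d u \<one>" using uv by (intro dist_translate) auto
    then show ?thesis using uv graph_dist_sym[of u \<one>] by (simp add: word_norm_def)
  qed
  moreover have "d u (u \<otimes> v) = word_norm v"
    using dist_translate[of u \<one> v] uv by (simp add: word_norm_def)
  ultimately show ?thesis by (simp add: word_norm_def)
qed

end

text \<open>
  Here \<open>N\<close> is any length function on the group for which the flat generated by \<open>g\<close> and \<open>h\<close> is
  undistorted. The lower bounds pass to the word norm by \<open>norm_lower_bound\<close>, and
  \<open>norm_parallelogram\<close> for \<open>u, v\<close> and for \<open>u v, u v\<^sup>-\<^sup>1\<close>, whose product and quotient are \<open>u\<^sup>2\<close> and \<open>v\<^sup>2\<close>,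
  gives the hypothesis of \<open>no_flat_lengths\<close>.
\<close>
lemma not_hyperbolic_if_undistorted_flat:
  fixes G (structure) and N :: "'a \<Rightarrow> nat"
  assumes "group G" and N1: "N \<one> = 0"
    and Nmult: "\<And>x y. x \<in> carrier G \<Longrightarrow> y \<in> carrier G \<Longrightarrow> N (x \<otimes> y) \<le> N x + N y"
    and Ninv: "\<And>x. x \<in> carrier G \<Longrightarrow> N (inv x) \<le> N x"
    and gh: "g \<in> carrier G" "h \<in> carrier G" "g \<otimes> h = h \<otimes> g"
    and lower: "\<And>i j. i \<le> N (g [^] (i::nat) \<otimes> h [^] (j::nat))"
      "\<And>i j. i \<le> N (g [^] (i::nat) \<otimes> inv (h [^] (j::nat)))"
      "\<And>j. j \<le> N (h [^] (j::nat))"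
  shows "\<not> hyperbolic_group G"
proof
  interpret group G by fact
  assume "hyperbolic_group G"
  then obtain S \<delta> where S: "finite S" "S \<subseteq> carrier G" "generate G S = carrier G" and \<delta>: "0 \<le> \<delta>"
    and hyp: "delta_hyperbolic (realization (carrier G) (cayley_edges G S))
         (realization_dist (cayley_edges G S)) \<delta>"
    unfolding hyperbolic_group_def by blast
  interpret cayley G S by unfold_locales (use S in auto)
  define M where "M = Suc (\<Sum>s\<in>S. N s)"
  define c where "c = 1 / real M"
  have M: "0 < real M" unfolding M_def by (simp only: of_nat_0_less_iff zero_less_Suc)
  then have c: "0 < c" by (simp add: c_def)
  have low: "c * real i \<le> real (word_norm x)" if "x \<in> carrier G" "i \<le> N x" for i x
  proof -
    have "N x \<le> (\<Sum>s\<in>S. N s) * word_norm x"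
      using norm_lower_bound[of N x] S N1 Nmult Ninv that by blast
    then have "i \<le> M * word_norm x" using that by (simp add: M_def)
    then have "real i \<le> real M * real (word_norm x)" by (metis of_nat_le_iff of_nat_mult)
    then show ?thesis using M by (simp add: c_def field_simps)
  qed
  let ?F = "\<lambda>i. real (word_norm (g [^] (i::nat)))" and ?H = "\<lambda>i. real (word_norm (h [^] (i::nat)))"
  let ?D = "4 * (\<delta> + 2)"
  show False
  proof (rule no_flat_lengths[of ?F c ?H ?D])
    show "?F (i + j) \<le> ?F i + ?F j" "?H (i + j) \<le> ?H i + ?H j" for i j
      using norm_mult[of "g [^] i" "g [^] j"] norm_mult[of "h [^] i" "h [^] j"] gh
      by (simp_all add: nat_pow_mult)
    show "?F 0 \<le> 0" "?H 0 \<le> 0" by (simp_all add: norm_one)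
    show "c * real i \<le> ?F i" for i
      using low[of "g [^] i" i] lower(1)[of i 0] gh by simp
    show "c * real i \<le> ?H i" for i
      using low[of "h [^] i" i] lower(3)[of i] gh by simp
    show "0 < c" by fact
    fix m l
    let ?u = "g [^] (m::nat)" and ?v = "h [^] (l::nat)"
    have uv: "?u \<in> carrier G" "?v \<in> carrier G" using gh by auto
    have comm: "?u \<otimes> ?v = ?v \<otimes> ?u"
      using gh by (metis nat_pow_closed group_commutes_pow)
    have comm': "?u \<otimes> inv ?v = inv ?v \<otimes> ?u"
      using uv comm by (metis inv_closed inv_solve_left inv_solve_right m_assoc m_closed)
    let ?p = "?u \<otimes> ?v" and ?q = "?u \<otimes> inv ?v"
    have pq: "?p \<in> carrier G" "?q \<in> carrier G" using uv by auto
    have "?p \<otimes> ?q = ?u \<otimes> (?v \<otimes> ?u) \<otimes> inv ?v" using uv by (simp add: m_assoc)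
    also have "\<dots> = ?u \<otimes> ?u" unfolding comm[symmetric] using uv by (simp add: m_assoc)
    finally have prod: "?p \<otimes> ?q = ?u \<otimes> ?u" .
    have "?q \<otimes> ?p = ?u \<otimes> (inv ?v \<otimes> ?u) \<otimes> ?v" using uv by (simp add: m_assoc)
    also have "\<dots> = ?u \<otimes> ?u" unfolding comm'[symmetric] using uv by (simp add: m_assoc)
    finally have prod': "?q \<otimes> ?p = ?u \<otimes> ?u" .
    have invq: "inv ?q = ?v \<otimes> inv ?u" using uv by (simp add: inv_mult_group)
    have "?p \<otimes> inv ?q = (?v \<otimes> ?u) \<otimes> (inv ?u \<otimes> ?v)"
      unfolding invq comm using uv comm by (metis inv_closed inv_solve_left inv_solve_right m_assoc m_closed)
    also have "\<dots> = ?v \<otimes> ?v" using uv by (simp add: m_assoc) (simp add: m_assoc[symmetric])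
    finally have quot: "?p \<otimes> inv ?q = ?v \<otimes> ?v" .
    have sq: "?u \<otimes> ?u = g [^] (2 * m)" "?v \<otimes> ?v = h [^] (2 * l)"
      using gh by (simp_all add: nat_pow_mult mult_2)
    show "\<exists>P Q. c * real m \<le> P \<and> c * real m \<le> Q \<and> P + Q \<le> 2 * max (?F m) (?H l) + ?D \<and>
      ?F (2 * m) + ?H (2 * l) \<le> 2 * max P Q + ?D"
    proof (intro exI conjI)
      show "c * real m \<le> real (word_norm ?p)" "c * real m \<le> real (word_norm ?q)"
        using low[OF pq(1) lower(1)] low[OF pq(2) lower(2)] by auto
      show "real (word_norm ?p) + real (word_norm ?q) \<le> 2 * max (?F m) (?H l) + ?D"
        using norm_parallelogram[OF hyp \<delta> uv comm] .
      show "?F (2 * m) + ?H (2 * l) \<le> 2 * max (real (word_norm ?p)) (real (word_norm ?q)) + ?D"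
        using norm_parallelogram[OF hyp \<delta> pq] prod prod' quot sq by simp
    qed
  qed
qed

section \<open>The geometric representation and signed crossings of mirrors\<close>

lemma uminus_uminus_fun [simp]: "- (- x) = x" for x :: "nat \<Rightarrow> real"
  by (simp add: fun_eq_iff)

text \<open>
  The bilinear form of the geometric representation has the value \<open>- edge_cos \<Gamma> i j\<close> on distinct
  basis vectors \<open>i, j\<close>. A missing edge may get any value, because it imposes no relation; 1 is the limit
  for large labels.
\<close>
definition edge_cos :: "labelled_graph \<Rightarrow> nat \<Rightarrow> nat \<Rightarrow> real" where
  "edge_cos \<Gamma> i j = (case \<Gamma> {i, j} of None \<Rightarrow> 1 | Some m \<Rightarrow> cos (pi / real m))"

definition unit_root :: "nat \<Rightarrow> nat \<Rightarrow> real" where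
  "unit_root i = (\<lambda>_. 0)(i := 1)"

definition reflection :: "nat \<Rightarrow> labelled_graph \<Rightarrow> nat \<Rightarrow> (nat \<Rightarrow> real) \<Rightarrow> nat \<Rightarrow> real" where
  "reflection n \<Gamma> i x = x(i := 2 * (\<Sum>j\<in>{..<n} - {i}. edge_cos \<Gamma> i j * x j) - x i)"

text \<open>
  The letters act from left to right, so a word acts as the inverse of its product. A letter and its
  formal inverse act alike since the generators are involutions.
\<close>
fun walk :: "nat \<Rightarrow> labelled_graph \<Rightarrow> nat word \<Rightarrow> (nat \<Rightarrow> real) \<Rightarrow> nat \<Rightarrow> real" where
  "walk n \<Gamma> [] x = x"
| "walk n \<Gamma> ((i, b) # u) x = walk n \<Gamma> u (reflection n \<Gamma> i x)"

definition root_sign :: "nat \<Rightarrow> (nat \<Rightarrow> real) \<Rightarrow> int" where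
  "root_sign i x = of_bool (x = unit_root i) - of_bool (x = - unit_root i)"

text \<open>
  A word \<open>s\<^sub>1 \<dots> s\<^sub>k\<close> describes a gallery of chambers that crosses, in its \<open>j\<close>-th step, the mirror with
  normal \<open>s\<^sub>1 \<dots> s\<^sub>j\<^sub>-\<^sub>1 e\<close>, where \<open>e\<close> is the unit root of \<open>s\<^sub>j\<close>. The normal is \<open>x\<close> or \<open>- x\<close> if and only if the
  prefix before \<open>s\<^sub>j\<close> walks \<open>x\<close> to \<open>e\<close> or \<open>- e\<close>. So this is the number of crossings of the mirror
  of \<open>x\<close> in the positive direction minus the number of those in the negative direction.
\<close>
fun crossing :: "nat \<Rightarrow> labelled_graph \<Rightarrow> nat word \<Rightarrow> (nat \<Rightarrow> real) \<Rightarrow> int" where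
  "crossing n \<Gamma> [] x = 0"
| "crossing n \<Gamma> ((i, b) # u) x = root_sign i x + crossing n \<Gamma> u (reflection n \<Gamma> i x)"

lemma walk_append: "walk n \<Gamma> (u @ v) x = walk n \<Gamma> v (walk n \<Gamma> u x)"
  by (induction n \<Gamma> u x rule: walk.induct) auto

lemma crossing_append:
  "crossing n \<Gamma> (u @ v) x = crossing n \<Gamma> u x + crossing n \<Gamma> v (walk n \<Gamma> u x)"
  by (induction n \<Gamma> u x rule: walk.induct) auto

lemma reflection_reflection [simp]: "reflection n \<Gamma> i (reflection n \<Gamma> i x) = x"
proof -
  have "(\<Sum>j\<in>{..<n} - {i}. edge_cos \<Gamma> i j * reflection n \<Gamma> i x j) =
      (\<Sum>j\<in>{..<n} - {i}. edge_cos \<Gamma> i j * x j)"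
    by (intro sum.cong) (auto simp: reflection_def)
  then show ?thesis
    unfolding reflection_def[of n \<Gamma> i "reflection n \<Gamma> i x"]
    by (auto simp: reflection_def fun_eq_iff)
qed

lemma reflection_uminus: "reflection n \<Gamma> i (- x) = - reflection n \<Gamma> i x"
  by (auto simp: reflection_def fun_eq_iff sum_negf)

lemma reflection_unit_root: "reflection n \<Gamma> i (unit_root i) = - unit_root i"
  by (auto simp: reflection_def unit_root_def fun_eq_iff sum.neutral)

lemma root_sign_reflection: "root_sign i (reflection n \<Gamma> i x) = - root_sign i x"
proof -
  have "reflection n \<Gamma> i x = unit_root i \<longleftrightarrow> x = - unit_root i"
    by (metis reflection_reflection reflection_uminus reflection_unit_root uminus_uminus_fun)
  moreover have "reflection n \<Gamma> i x = - unit_root i \<longleftrightarrow> x = unit_root i"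
    by (metis reflection_reflection reflection_unit_root)
  ultimately show ?thesis
    by (simp add: root_sign_def)
qed

text \<open>Each letter crosses exactly one mirror, and \<open>A\<close> contains at most one of its two normals.\<close>
lemma crossing_sum_le_length:
  assumes "finite A" "\<And>x. x \<in> A \<Longrightarrow> - x \<notin> A"
  shows "(\<Sum>x\<in>A. \<bar>crossing n \<Gamma> u x\<bar>) \<le> int (length u)"
  using assms
proof (induction u arbitrary: A)
  case Nil
  then show ?case by simp
next
  case (Cons l u)
  obtain i b where l: "l = (i, b)" by (cases l)
  let ?r = "reflection n \<Gamma> i"
  have inj: "inj_on ?r A"
    by (metis inj_onI reflection_reflection)
  have "(\<Sum>x\<in>A. \<bar>root_sign i x\<bar>) \<le> 1"
  proof -
    have "(\<Sum>x\<in>A. \<bar>root_sign i x\<bar>) = (\<Sum>x\<in>A \<inter> {unit_root i, - unit_root i}. \<bar>root_sign i x\<bar>)"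
      using Cons.prems(1) by (intro sum.mono_neutral_right) (auto simp: root_sign_def)
    also have "\<dots> \<le> (\<Sum>x\<in>A \<inter> {unit_root i, - unit_root i}. 1)"
      by (intro sum_mono) (auto simp: root_sign_def)
    also have "\<dots> = int (card (A \<inter> {unit_root i, - unit_root i}))"
      by simp
    also have "card (A \<inter> {unit_root i, - unit_root i}) \<le> 1"
    proof -
      have "A \<inter> {unit_root i, - unit_root i} \<subseteq> {unit_root i} \<or>
          A \<inter> {unit_root i, - unit_root i} \<subseteq> {- unit_root i}"
        using Cons.prems(2)[of "unit_root i"] by blast
      then show ?thesis
        using card_mono[of "{unit_root i}"] card_mono[of "{- unit_root i}"] by fastforce
    qed
    finally show ?thesis by simp
  qed
  moreover have "(\<Sum>x\<in>A. \<bar>crossing n \<Gamma> u (?r x)\<bar>) \<le> int (length u)"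
  proof -
    have "(\<Sum>x\<in>A. \<bar>crossing n \<Gamma> u (?r x)\<bar>) = (\<Sum>x\<in>?r ` A. \<bar>crossing n \<Gamma> u x\<bar>)"
      using inj by (simp add: sum.reindex)
    also have "\<dots> \<le> int (length u)"
    proof (rule Cons.IH)
      fix x assume "x \<in> ?r ` A"
      then obtain y where y: "y \<in> A" "x = ?r y" by auto
      show "- x \<notin> ?r ` A"
      proof
        assume "- x \<in> ?r ` A"
        then obtain z where "z \<in> A" "?r z = - ?r y" using y by force
        moreover from this have "z = - y"
          by (metis reflection_reflection reflection_uminus)
        ultimately show False using Cons.prems(2) y by auto
      qed
    qed (use Cons.prems in auto)
    finally show ?thesis .
  qed
  moreover have "(\<Sum>x\<in>A. \<bar>crossing n \<Gamma> (l # u) x\<bar>) \<le>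
      (\<Sum>x\<in>A. \<bar>root_sign i x\<bar>) + (\<Sum>x\<in>A. \<bar>crossing n \<Gamma> u (?r x)\<bar>)"
    unfolding sum.distrib[symmetric] by (intro sum_mono) (auto simp: l)
  ultimately show ?case by simp
qed

text \<open>
  The sequence with first terms \<open>y0, y1\<close> and \<open>y\<^sub>k\<^sub>+\<^sub>2 = 2 cos \<theta> y\<^sub>k\<^sub>+\<^sub>1 - y\<^sub>k\<close>. Two reflections at an
  angle \<open>\<theta>\<close>, applied alternately, replace one of two coordinates by the next term in each step.
  For \<open>\<theta> = \<pi> / m\<close> the sequence changes its sign after \<open>m\<close> steps. This is the source of both the relation
  \<open>(s t)\<^sup>m = 1\<close> and the cancellation of the crossings of this relator.
\<close>
definition chord :: "real \<Rightarrow> real \<Rightarrow> real \<Rightarrow> nat \<Rightarrow> real" where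
  "chord \<theta> y0 y1 k = (y1 * sin (real k * \<theta>) - y0 * sin ((real k - 1) * \<theta>)) / sin \<theta>"

lemma chord_0: "sin \<theta> \<noteq> 0 \<Longrightarrow> chord \<theta> y0 y1 0 = y0"
  and chord_1: "sin \<theta> \<noteq> 0 \<Longrightarrow> chord \<theta> y0 y1 (Suc 0) = y1"
  by (auto simp: chord_def)

lemma chord_rec: "chord \<theta> y0 y1 (Suc (Suc k)) = 2 * cos \<theta> * chord \<theta> y0 y1 (Suc k) - chord \<theta> y0 y1 k"
proof -
  have *: "sin (t + \<theta>) = 2 * cos \<theta> * sin t - sin (t - \<theta>)" for t
    by (simp add: sin_add sin_diff)
  have "sin (real (Suc (Suc k)) * \<theta>) = 2 * cos \<theta> * sin (real (Suc k) * \<theta>) - sin (real k * \<theta>)"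
    using *[of "real (Suc k) * \<theta>"] by (simp add: algebra_simps)
  moreover have "sin ((real (Suc (Suc k)) - 1) * \<theta>) =
      2 * cos \<theta> * sin ((real (Suc k) - 1) * \<theta>) - sin ((real k - 1) * \<theta>)"
    using *[of "real k * \<theta>"] by (simp add: algebra_simps)
  moreover have "(y1 * (2 * c * a1 - a0) - y0 * (2 * c * b1 - b0)) / s =
      2 * c * ((y1 * a1 - y0 * b1) / s) - (y1 * a0 - y0 * b0) / s" for a0 a1 b0 b1 c s :: real
    by (simp add: divide_inverse algebra_simps)
  ultimately show ?thesis
    by (simp only: chord_def)
qed

lemma chord_antiperiodic:
  assumes "0 < m"
  shows "chord (pi / real m) y0 y1 (k + m) = - chord (pi / real m) y0 y1 k"
proof -
  have 1: "real (k + m) * (pi / real m) = real k * (pi / real m) + pi"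
    using assms by (simp add: field_simps)
  have 2: "(real (k + m) - 1) * (pi / real m) = (real k - 1) * (pi / real m) + pi"
    using assms by (simp add: field_simps)
  have 3: "(y1 * - a - y0 * - b) / s = - ((y1 * a - y0 * b) / s)" for a b s :: real
    by (simp add: divide_inverse algebra_simps)
  show ?thesis
    unfolding chord_def 1 2 sin_periodic_pi 3 ..
qed

lemma concat_replicate_Suc: "concat (replicate (Suc k) u) = concat (replicate k u) @ u"
  by (induction k) auto

lemma sum_lessThan_add: "(\<Sum>t<m + k. h t) = (\<Sum>t<m. h t) + (\<Sum>t<k. h (t + m))"
  for h :: "nat \<Rightarrow> int"
  by (induction k) (simp_all add: add.commute)

text \<open>
  A label 1 would identify two generators, which then could not act by the reflections in two
  different unit roots.
\<close>
locale coxeter_rep =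
  fixes n :: nat and \<Gamma> :: labelled_graph
  assumes label_ge_2: "\<And>i j m. i < n \<Longrightarrow> j < n \<Longrightarrow> i \<noteq> j \<Longrightarrow> \<Gamma> {i, j} = Some m \<Longrightarrow> 2 \<le> m"
begin

context
  fixes i j m :: nat
  assumes ij: "i < n" "j < n" "i \<noteq> j" and m: "\<Gamma> {i, j} = Some m"
begin

abbreviation (input) "\<theta> \<equiv> pi / real m"

lemma edge_label_ge_2: "2 \<le> m"
  using label_ge_2[OF ij m] .

lemma sin_angle_pos: "sin \<theta> > 0"
  using edge_label_ge_2 by (intro sin_gt_zero) (auto simp: field_simps)

text \<open>The contribution to the reflection at \<open>k\<close> of the coordinates other than \<open>i, j\<close>. It stays constant
  while only these two reflections are applied.\<close>
definition rest :: "nat \<Rightarrow> (nat \<Rightarrow> real) \<Rightarrow> real" where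
  "rest k x = 2 * (\<Sum>l\<in>{..<n} - {i, j}. edge_cos \<Gamma> k l * x l)"

lemma rest_upd [simp]: "k \<in> {i, j} \<Longrightarrow> rest l (x(k := a)) = rest l x"
  unfolding rest_def by (intro arg_cong[of _ _ "(*) 2"] sum.cong) auto

lemma reflection_left: "reflection n \<Gamma> i x = x(i := 2 * cos \<theta> * x j + rest i x - x i)"
proof -
  have set_eq: "{..<n} - {i} = insert j ({..<n} - {i, j})" using ij by auto
  have "(\<Sum>l\<in>{..<n} - {i}. edge_cos \<Gamma> i l * x l) =
      edge_cos \<Gamma> i j * x j + (\<Sum>l\<in>{..<n} - {i, j}. edge_cos \<Gamma> i l * x l)"
    unfolding set_eq by (subst sum.insert) auto
  then show ?thesis using m by (simp add: reflection_def rest_def edge_cos_def algebra_simps)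
qed

lemma reflection_right: "reflection n \<Gamma> j x = x(j := 2 * cos \<theta> * x i + rest j x - x j)"
proof -
  have set_eq: "{..<n} - {j} = insert i ({..<n} - {i, j})" using ij by auto
  have "(\<Sum>l\<in>{..<n} - {j}. edge_cos \<Gamma> j l * x l) =
      edge_cos \<Gamma> j i * x i + (\<Sum>l\<in>{..<n} - {i, j}. edge_cos \<Gamma> j l * x l)"
    unfolding set_eq by (subst sum.insert) auto
  then show ?thesis using m
    by (simp add: reflection_def rest_def edge_cos_def algebra_simps insert_commute)
qed

text \<open>
  With the other coordinates fixed, the reflections act on the coordinates \<open>i, j\<close> by affine maps with
  the common fixed point \<open>(p, q)\<close>; relative to it they follow the sequence \<open>chord\<close>.
\<close>
lemma walk_alternating:
  assumes p: "2 * p = 2 * cos \<theta> * q + rest i x" and q: "2 * q = 2 * cos \<theta> * p + rest j x"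
  shows "walk n \<Gamma> (concat (replicate k [(i, True), (j, True)])) x =
    x(i := chord \<theta> (x i - p) (x j - q) (2 * k) + p, j := chord \<theta> (x i - p) (x j - q) (Suc (2 * k)) + q)"
proof (induction k)
  case 0
  then show ?case using sin_angle_pos by (simp add: chord_0 chord_1)
next
  case (Suc k)
  let ?y = "chord \<theta> (x i - p) (x j - q)"
  have "walk n \<Gamma> (concat (replicate (Suc k) [(i, True), (j, True)])) x =
      reflection n \<Gamma> j (reflection n \<Gamma> i (x(i := ?y (2 * k) + p, j := ?y (Suc (2 * k)) + q)))"
    unfolding concat_replicate_Suc walk_append Suc by simp
  also have "reflection n \<Gamma> i (x(i := ?y (2 * k) + p, j := ?y (Suc (2 * k)) + q)) =
      x(i := ?y (Suc (Suc (2 * k))) + p, j := ?y (Suc (2 * k)) + q)"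
    unfolding reflection_left using ij p by (auto simp: fun_eq_iff chord_rec algebra_simps)
  also have "reflection n \<Gamma> j \<dots> =
      x(i := ?y (Suc (Suc (2 * k))) + p, j := ?y (Suc (Suc (Suc (2 * k)))) + q)"
    unfolding reflection_right using ij q
    by (auto simp: fun_eq_iff chord_rec[of _ _ _ "Suc (k * 2)"] algebra_simps)
  finally show ?case by (simp only: mult_Suc_right add_2_eq_Suc)
qed

lemma walk_edge_relator: "walk n \<Gamma> (concat (replicate m [(i, True), (j, True)])) x = x"
proof -
  let ?c = "cos \<theta>"
  have solve: "2 * ((P + c * Q) / (2 * S)) = 2 * c * ((Q + c * P) / (2 * S)) + P"
    if "S \<noteq> 0" "S = 1 - c\<^sup>2" for P Q S c :: real
  proof -
    have "P + c * Q = c * (Q + c * P) + P * S"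
      by (simp add: that(2) algebra_simps power2_eq_square)
    then have quot: "(P + c * Q) / S = (c * (Q + c * P)) / S + P * S / S"
      by (simp only: add_divide_distrib)
    have halve: "2 * (X / (2 * S)) = X / S" "2 * c * (X / (2 * S)) = c * X / S" for X
      using that(1) by simp_all
    show ?thesis unfolding halve quot using that(1) by simp
  qed
  define p where "p = (rest i x + ?c * rest j x) / (2 * (sin \<theta>)^2)"
  define q where "q = (rest j x + ?c * rest i x) / (2 * (sin \<theta>)^2)"
  have s: "(sin \<theta>)^2 = 1 - ?c^2" "(sin \<theta>)^2 \<noteq> 0"
    by (rule sin_squared_eq) (rule power_not_zero[OF less_imp_neq[OF sin_angle_pos, symmetric]])
  have p: "2 * p = 2 * cos \<theta> * q + rest i x" and q: "2 * q = 2 * cos \<theta> * p + rest j x"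
    unfolding p_def q_def by (rule solve[OF s(2) s(1)])+
  have per: "chord \<theta> a b (2 * m + k) = chord \<theta> a b k" for a b k
    using chord_antiperiodic[of m a b k] chord_antiperiodic[of m a b "k + m"] edge_label_ge_2
    by (simp add: mult_2 add_ac)
  show ?thesis
    unfolding walk_alternating[OF p q] using per[of _ _ 0] per[of _ _ "Suc 0"] sin_angle_pos
    by (simp add: fun_eq_iff chord_0 chord_1)
qed

text \<open>
  For a vector supported on \<open>{i, j}\<close>, being carried to the unit root of the next letter means that
  the current term of the sequence is 1 and the next one is 0, no matter whose turn it is.
\<close>
lemma crossing_alternating:
  assumes z: "\<And>l. l \<notin> {i, j} \<Longrightarrow> x l = 0"
  shows "crossing n \<Gamma> (concat (replicate k [(i, True), (j, True)])) x =
    (\<Sum>t<2 * k. of_bool (chord \<theta> (x i) (x j) t = 1 \<and> chord \<theta> (x i) (x j) (Suc t) = 0) -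
      of_bool (chord \<theta> (x i) (x j) t = - 1 \<and> chord \<theta> (x i) (x j) (Suc t) = 0))"
proof (induction k)
  case 0
  then show ?case by simp
next
  case (Suc k)
  let ?y = "chord \<theta> (x i) (x j)"
  have r0: "rest l x = 0" for l
    using z by (auto simp: rest_def sum.neutral)
  have w: "walk n \<Gamma> (concat (replicate k [(i, True), (j, True)])) x =
      x(i := ?y (2 * k), j := ?y (Suc (2 * k)))"
    using walk_alternating[of 0 0 x] by (simp add: r0)
  have w': "reflection n \<Gamma> i (x(i := ?y (2 * k), j := ?y (Suc (2 * k)))) =
      x(i := ?y (Suc (Suc (2 * k))), j := ?y (Suc (2 * k)))"
    unfolding reflection_left using ij r0 by (auto simp: fun_eq_iff chord_rec algebra_simps)
  have "root_sign i (x(i := a, j := b)) = of_bool (a = 1 \<and> b = 0) - of_bool (a = - 1 \<and> b = 0)"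
    and "root_sign j (x(i := a, j := b)) = of_bool (b = 1 \<and> a = 0) - of_bool (b = - 1 \<and> a = 0)" for a b
    unfolding root_sign_def unit_root_def using z ij by (auto simp: fun_eq_iff)
  then show ?case
    unfolding concat_replicate_Suc crossing_append Suc w by (simp add: w')
qed

text \<open>
  The second half of the relator crosses the same mirrors as the first half, in the opposite
  direction. A vector with another nonzero coordinate keeps it and never meets a unit root of \<open>i\<close> or \<open>j\<close>.
\<close>
lemma crossing_edge_relator: "crossing n \<Gamma> (concat (replicate m [(i, True), (j, True)])) x = 0"
proof (cases "\<forall>l. l \<notin> {i, j} \<longrightarrow> x l = 0")
  case True
  let ?y = "chord \<theta> (x i) (x j)"
  let ?h = "\<lambda>t. of_bool (?y t = 1 \<and> ?y (Suc t) = 0) - of_bool (?y t = - 1 \<and> ?y (Suc t) = 0) :: int"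
  have "?h (t + m) = - ?h t" for t
    using chord_antiperiodic[of m "x i" "x j" t] chord_antiperiodic[of m "x i" "x j" "Suc t"] edge_label_ge_2
    by auto
  then have "sum ?h {..<m + m} = 0"
    unfolding sum_lessThan_add by (simp only: sum_negf)
  then show ?thesis
    using crossing_alternating[of x m] True by (simp add: mult_2)
next
  case False
  then obtain l where l: "l \<noteq> i" "l \<noteq> j" "x l \<noteq> 0" by auto
  have "crossing n \<Gamma> u y = 0" if "fst ` set u \<subseteq> {i, j}" "y l \<noteq> 0" for u y
    using that
  proof (induction u arbitrary: y)
    case (Cons a u)
    obtain k b where a: "a = (k, b)" by (cases a)
    have k: "k \<in> {i, j}" using Cons.prems a by auto
    then have "reflection n \<Gamma> k y l = y l" using l by (auto simp: reflection_def)
    moreover have "root_sign k y = 0"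
    proof -
      have "y l \<noteq> unit_root k l" "y l \<noteq> - unit_root k l"
        using k l Cons.prems by (auto simp: unit_root_def)
      then show ?thesis by (auto simp: root_sign_def)
    qed
    ultimately show ?case using Cons a by auto
  qed simp
  moreover have "fst ` set (concat (replicate m [(i, True), (j, True)])) \<subseteq> {i, j}" by auto
  ultimately show ?thesis using l by blast
qed

end

lemma walk_crossing_relator:
  assumes "r \<in> coxeter_relators n \<Gamma>"
  shows "walk n \<Gamma> r x = x" "crossing n \<Gamma> r x = 0"
proof -
  consider i where "r = [(i, True), (i, True)]"
    | i j m where "i < n" "j < n" "i \<noteq> j" "\<Gamma> {i, j} = Some m"
      "r = concat (replicate m [(i, True), (j, True)])"
    using assms by (auto simp: coxeter_relators_def)
  then have "walk n \<Gamma> r x = x \<and> crossing n \<Gamma> r x = 0"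
  proof cases
    case 1
    then show ?thesis by (simp add: root_sign_reflection)
  next
    case 2
    then show ?thesis using walk_edge_relator crossing_edge_relator by simp
  qed
  then show "walk n \<Gamma> r x = x" "crossing n \<Gamma> r x = 0" by simp_all
qed

lemma word_eq_walk_crossing:
  assumes "word_eq {..<n} (coxeter_relators n \<Gamma>) u v"
  shows "walk n \<Gamma> u = walk n \<Gamma> v \<and> crossing n \<Gamma> u = crossing n \<Gamma> v"
  using assms
proof (induction rule: word_eq.induct)
  case (cancel u v s b)
  then show ?case
    by (auto simp: fun_eq_iff walk_append crossing_append root_sign_reflection)
next
  case (relator u v r)
  then show ?case
    by (auto simp: fun_eq_iff walk_append crossing_append walk_crossing_relator)
qed auto

end

section \<open>The Euclidean triangle group with labels 2, 4, 4\<close>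

definition triangle_244 :: "nat \<Rightarrow> labelled_graph \<Rightarrow> nat \<Rightarrow> nat \<Rightarrow> nat \<Rightarrow> bool" where
  "triangle_244 n \<Gamma> a b c \<longleftrightarrow> a < n \<and> b < n \<and> c < n \<and> a \<noteq> b \<and> a \<noteq> c \<and> b \<noteq> c \<and>
    \<Gamma> {a, b} = Some 4 \<and> \<Gamma> {a, c} = Some 4 \<and> \<Gamma> {b, c} = Some 2"

lemma triangle_244_swap: "triangle_244 n \<Gamma> a b c \<Longrightarrow> triangle_244 n \<Gamma> a c b"
  by (auto simp: triangle_244_def insert_commute)

text \<open>
  A vector \<open>x\<close> supported on \<open>{a, b, c}\<close> stands for the function
  \<open>x b * X + x c * Y + x a * (1 - X - Y) / sqrt 2\<close> on the Euclidean plane, so that the three unit roots are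
  the inward unit normals of the triangle \<open>X \<ge> 0, Y \<ge> 0, X + Y \<le> 1\<close> and the generators act by the
  reflections in its sides. The vector \<open>mirror a b c k\<close> stands for \<open>X - k\<close>, and \<open>mirror a c b k\<close> for \<open>Y - k\<close>.
\<close>
definition mirror :: "nat \<Rightarrow> nat \<Rightarrow> nat \<Rightarrow> int \<Rightarrow> nat \<Rightarrow> real" where
  "mirror a b c k = (\<lambda>_. 0)(a := - sqrt 2 * of_int k, b := 1 - of_int k, c := - of_int k)"

lemma edge_cos_4: "\<Gamma> {i, j} = Some 4 \<Longrightarrow> edge_cos \<Gamma> i j = sqrt 2 / 2"
  by (simp add: edge_cos_def cos_45)

lemma edge_cos_2: "\<Gamma> {i, j} = Some 2 \<Longrightarrow> edge_cos \<Gamma> i j = 0"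
  by (simp add: edge_cos_def)

lemma reflection_supported:
  assumes "i < n" "j < n" "k < n" "i \<noteq> j" "i \<noteq> k" "j \<noteq> k"
    and "\<And>l. l \<notin> {i, j, k} \<Longrightarrow> x l = 0"
  shows "reflection n \<Gamma> i x = x(i := 2 * (edge_cos \<Gamma> i j * x j + edge_cos \<Gamma> i k * x k) - x i)"
proof -
  have "(\<Sum>l\<in>{..<n} - {i}. edge_cos \<Gamma> i l * x l) = (\<Sum>l\<in>{j, k}. edge_cos \<Gamma> i l * x l)"
    using assms by (intro sum.mono_neutral_right) auto
  then show ?thesis using assms by (simp add: reflection_def)
qed

text \<open>
  The value of the function of \<open>x\<close> at the point \<open>(1/4, 1/4)\<close> inside the triangle. Its sign tells on
  which side of the line of \<open>x\<close> this point lies.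
\<close>
definition height :: "nat \<Rightarrow> nat \<Rightarrow> nat \<Rightarrow> (nat \<Rightarrow> real) \<Rightarrow> real" where
  "height a b c x = x b / 4 + x c / 4 + x a * sqrt 2 / 4"

lemma height_mirror:
  "a \<noteq> b \<Longrightarrow> a \<noteq> c \<Longrightarrow> b \<noteq> c \<Longrightarrow> height a b c (mirror a b c k) = 1 / 4 - of_int k"
  by (simp add: height_def mirror_def field_simps)

lemma height_swap: "height a c b x = height a b c x"
  by (simp add: height_def)

lemma height_uminus: "height a b c (- x) = - height a b c x"
  by (simp add: height_def)

lemma mirror_neq:
  assumes "a \<noteq> b" "a \<noteq> c" "b \<noteq> c"
  shows "mirror a b c k = mirror a b c l \<longleftrightarrow> k = l" and "mirror a b c k \<noteq> - mirror a b c l"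
proof -
  show "mirror a b c k = mirror a b c l \<longleftrightarrow> k = l"
    using assms by (auto simp: mirror_def fun_eq_iff split: if_splits)
  show "mirror a b c k \<noteq> - mirror a b c l"
  proof
    assume eq: "mirror a b c k = - mirror a b c l"
    from fun_cong[OF eq, of c] have "k = - l"
      using assms by (simp add: mirror_def)
    moreover from fun_cong[OF eq, of b] have "real_of_int k + real_of_int l = 2"
      using assms by (simp add: mirror_def)
    ultimately show False by simp
  qed
qed

lemma reflect_mirror:
  assumes t: "triangle_244 n \<Gamma> a b c"
  shows "reflection n \<Gamma> a (mirror a b c k) = - mirror a c b (1 - k)"
    and "reflection n \<Gamma> b (mirror a b c k) = - mirror a b c (- k)"
    and "reflection n \<Gamma> c (mirror a b c k) = mirror a b c k"
proof -
  have d: "a < n" "b < n" "c < n" "a \<noteq> b" "a \<noteq> c" "b \<noteq> c"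
    and e: "edge_cos \<Gamma> a b = sqrt 2 / 2" "edge_cos \<Gamma> a c = sqrt 2 / 2" "edge_cos \<Gamma> b c = 0"
      "edge_cos \<Gamma> b a = sqrt 2 / 2" "edge_cos \<Gamma> c a = sqrt 2 / 2" "edge_cos \<Gamma> c b = 0"
    using t by (auto simp: triangle_244_def edge_cos_4 edge_cos_2 insert_commute)
  have z: "l \<notin> {a, b, c} \<Longrightarrow> mirror a b c k l = 0" for l
    by (auto simp: mirror_def)
  show "reflection n \<Gamma> a (mirror a b c k) = - mirror a c b (1 - k)"
    using d z by (subst reflection_supported[of a n b c])
      (auto simp: e mirror_def fun_eq_iff field_simps)
  show "reflection n \<Gamma> b (mirror a b c k) = - mirror a b c (- k)"
    using d z by (subst reflection_supported[of b n a c])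
      (auto simp: e mirror_def fun_eq_iff field_simps)
  show "reflection n \<Gamma> c (mirror a b c k) = mirror a b c k"
    using d z by (subst reflection_supported[of c n a b])
      (auto simp: e mirror_def fun_eq_iff field_simps)
qed

definition mirrors :: "nat \<Rightarrow> nat \<Rightarrow> nat \<Rightarrow> (nat \<Rightarrow> real) set" where
  "mirrors a b c = (\<Union>k. {mirror a b c k, - mirror a b c k, mirror a c b k, - mirror a c b k})"

lemma mirrors_swap: "mirrors a c b = mirrors a b c"
  by (auto simp: mirrors_def)

lemma mirrors_uminus: "x \<in> mirrors a b c \<Longrightarrow> - x \<in> mirrors a b c"
  by (auto simp: mirrors_def)

lemma root_sign_uminus: "root_sign i (- x) = - root_sign i x"
proof -
  have "- x = unit_root i \<longleftrightarrow> x = - unit_root i"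
    by (metis uminus_uminus_fun)
  moreover have "- x = - unit_root i \<longleftrightarrow> x = unit_root i"
    by (metis uminus_uminus_fun)
  ultimately show ?thesis by (simp add: root_sign_def)
qed

lemma root_sign_mirror_aux:
  assumes t: "triangle_244 n \<Gamma> a b c" and s: "s \<in> {a, b, c}" and x: "x = mirror a b c k"
  shows "reflection n \<Gamma> s x \<in> mirrors a b c"
    and "root_sign s x = of_bool (height a b c (reflection n \<Gamma> s x) < 0) - of_bool (height a b c x < 0)"
    and "height a b c x \<noteq> 0"
    and "height a b c (reflection n \<Gamma> s x) \<noteq> 0"
proof -
  have d: "a \<noteq> b" "a \<noteq> c" "b \<noteq> c"
    using t by (auto simp: triangle_244_def)
  have h: "height a b c (mirror a b c l) = 1 / 4 - of_int l"
    "height a b c (mirror a c b l) = 1 / 4 - of_int l" for l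
    using height_mirror[of a b c] height_mirror[of a c b] d height_swap[of a b c] by auto
  have int: "1 / 4 - real_of_int l < 0 \<longleftrightarrow> 1 \<le> l" "- (1 / 4 - real_of_int l) < 0 \<longleftrightarrow> l \<le> 0"
    "1 / 4 - real_of_int l \<noteq> 0" "- (1 / 4 - real_of_int l) \<noteq> 0" for l
    by (cases "1 \<le> l"; simp; linarith)+
  have z: "root_sign s (mirror a b c k) = (if s = b \<and> k = 0 then 1 else 0)"
  proof -
    have vals: "mirror a b c k a = - sqrt 2 * of_int k" "mirror a b c k b = 1 - of_int k"
      "mirror a b c k c = - of_int k"
      using d by (simp_all add: mirror_def)
    have "s = b \<and> k = 0" if eq: "mirror a b c k = unit_root s"
      using fun_cong[OF eq, of a] fun_cong[OF eq, of b] fun_cong[OF eq, of c] s d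
      unfolding vals by (auto simp: unit_root_def)
    moreover have "mirror a b c 0 = unit_root b"
      using d by (auto simp: mirror_def unit_root_def)
    moreover have "mirror a b c k \<noteq> - unit_root s"
    proof
      assume eq: "mirror a b c k = - unit_root s"
      show False
        using fun_cong[OF eq, of a] fun_cong[OF eq, of b] fun_cong[OF eq, of c] s d
        unfolding vals by (auto simp: unit_root_def)
    qed
    ultimately show ?thesis by (auto simp: root_sign_def)
  qed
  show "reflection n \<Gamma> s x \<in> mirrors a b c"
    using s reflect_mirror[OF t] unfolding x mirrors_def by auto
  show "height a b c x \<noteq> 0" unfolding x h by (rule int)
  consider "s = a" | "s = b" | "s = c" using s by auto
  then have "height a b c (reflection n \<Gamma> s x) \<noteq> 0 \<and>
    root_sign s x = of_bool (height a b c (reflection n \<Gamma> s x) < 0) - of_bool (height a b c x < 0)"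
  proof cases
    case 1
    have "root_sign a (mirror a b c k) = 0" using z d unfolding 1 by simp
    then show ?thesis
      unfolding x 1 reflect_mirror[OF t] height_uminus h int using int(4)[of "1 - k"] by auto
  next
    case 2
    have "root_sign b (mirror a b c k) = of_bool (k = 0)" using z d unfolding 2 by simp
    then show ?thesis
      unfolding x 2 reflect_mirror[OF t] height_uminus h int using int(4) by auto
  next
    case 3
    have "root_sign c (mirror a b c k) = 0" using z d unfolding 3 by simp
    then show ?thesis
      unfolding x 3 reflect_mirror[OF t] height_uminus h int using int by auto
  qed
  then show "height a b c (reflection n \<Gamma> s x) \<noteq> 0"
    and "root_sign s x = of_bool (height a b c (reflection n \<Gamma> s x) < 0) - of_bool (height a b c x < 0)"
    by blast+
qed

text \<open>
  Of the lines \<open>X = k\<close> and \<open>Y = k\<close>, the only ones that separate the point \<open>(1/4, 1/4)\<close> from its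
  images under \<open>b\<close> and \<open>c\<close> are \<open>X = 0\<close> and \<open>Y = 0\<close> respectively, and none separates it from its image under \<open>a\<close>.
  This is what makes \<open>root_sign\<close> a difference, and \<open>crossing\<close> a telescoping sum.
\<close>
lemma root_sign_mirrors:
  assumes t: "triangle_244 n \<Gamma> a b c" and s: "s \<in> {a, b, c}" and x: "x \<in> mirrors a b c"
  shows "reflection n \<Gamma> s x \<in> mirrors a b c"
    and "root_sign s x = of_bool (height a b c (reflection n \<Gamma> s x) < 0) - of_bool (height a b c x < 0)"
proof -
  let ?P = "\<lambda>x. reflection n \<Gamma> s x \<in> mirrors a b c \<and>
    root_sign s x = of_bool (height a b c (reflection n \<Gamma> s x) < 0) - of_bool (height a b c x < 0) \<and>
    height a b c x \<noteq> 0 \<and> height a b c (reflection n \<Gamma> s x) \<noteq> 0"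
  have "?P (mirror a b c k)" for k
    using root_sign_mirror_aux[OF t s HOL.refl] by blast
  moreover have "?P (mirror a c b k)" for k
    using root_sign_mirror_aux[OF triangle_244_swap[OF t], of s "mirror a c b k" k] s
    unfolding mirrors_swap[of a c b] height_swap[of a c b] by blast
  moreover have "?P (- x)" if "?P x" for x
    using that mirrors_uminus[of "reflection n \<Gamma> s x" a b c]
    by (auto simp: reflection_uminus root_sign_uminus height_uminus)
  ultimately have "?P x"
    using x unfolding mirrors_def by blast
  then show "reflection n \<Gamma> s x \<in> mirrors a b c"
    and "root_sign s x = of_bool (height a b c (reflection n \<Gamma> s x) < 0) - of_bool (height a b c x < 0)"
    by blast+
qed

lemma crossing_eq_height:
  assumes t: "triangle_244 n \<Gamma> a b c"
  shows "fst ` set u \<subseteq> {a, b, c} \<Longrightarrow> x \<in> mirrors a b c \<Longrightarrow>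
    crossing n \<Gamma> u x = of_bool (height a b c (walk n \<Gamma> u x) < 0) - of_bool (height a b c x < 0)"
proof (induction u arbitrary: x)
  case (Cons l u)
  obtain i e where l: "l = (i, e)" by (cases l)
  have i: "i \<in> {a, b, c}" using Cons.prems l by simp
  show ?case
    using Cons.IH[OF _ root_sign_mirrors(1)[OF t i Cons.prems(2)]] Cons.prems(1)
      root_sign_mirrors(2)[OF t i Cons.prems(2)] by (simp add: l)
qed simp

text \<open>The product of the reflections in \<open>X = 1\<close> (which is \<open>aca\<close>) and in \<open>X = 0\<close>, that is, the translation
  by 2 in the direction of \<open>X\<close>. Exchanging \<open>b\<close> and \<open>c\<close> gives the translation in the direction of \<open>Y\<close>.\<close>
definition translation_word :: "nat \<Rightarrow> nat \<Rightarrow> nat \<Rightarrow> nat word" where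
  "translation_word a b c = [(a, True), (c, True), (a, True), (b, True)]"

lemma walk_translation_word:
  assumes t: "triangle_244 n \<Gamma> a b c"
  shows "walk n \<Gamma> (translation_word a b c) (mirror a b c k) = mirror a b c (k - 2)"
    and "walk n \<Gamma> (translation_word a c b) (mirror a b c k) = mirror a b c k"
    and "walk n \<Gamma> (rev (translation_word a c b)) (mirror a b c k) = mirror a b c k"
  using reflect_mirror[OF t] reflect_mirror[OF triangle_244_swap[OF t]]
  by (simp_all add: translation_word_def reflection_uminus)

lemma walk_translation_power:
  assumes "triangle_244 n \<Gamma> a b c"
  shows "walk n \<Gamma> (concat (replicate i (translation_word a b c))) (mirror a b c k) =
    mirror a b c (k - 2 * int i)"
  by (induction i arbitrary: k) (simp_all add: walk_append walk_translation_word[OF assms] algebra_simps)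

lemma walk_power_fixed:
  assumes "walk n \<Gamma> u x = x"
  shows "walk n \<Gamma> (concat (replicate j u)) x = x"
  by (induction j) (simp_all add: walk_append assms)

context coxeter_rep
begin

text \<open>
  The translation part \<open>w\<close> in the direction of \<open>Y\<close> preserves the lines \<open>X = k\<close>, so the path from the
  triangle to its image crosses exactly those with \<open>1 \<le> k \<le> 2 i\<close>, each of them once more in the negative
  than in the positive direction. Every other word for the same element has the same crossings.
\<close>
lemma translation_length:
  assumes t: "triangle_244 n \<Gamma> a b c"
    and w: "w \<in> {translation_word a c b, rev (translation_word a c b)}"
    and eq: "word_eq {..<n} (coxeter_relators n \<Gamma>)
      (concat (replicate i (translation_word a b c)) @ concat (replicate j w)) u"
  shows "2 * i \<le> length u"
proof -
  let ?v = "concat (replicate i (translation_word a b c)) @ concat (replicate j w)"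
  have d: "a \<noteq> b" "a \<noteq> c" "b \<noteq> c"
    using t by (auto simp: triangle_244_def)
  let ?A = "mirror a b c ` {1..2 * int i}"
  have "crossing n \<Gamma> u (mirror a b c k) = - 1" if k: "k \<in> {1..2 * int i}" for k
  proof -
    have "crossing n \<Gamma> u (mirror a b c k) = crossing n \<Gamma> ?v (mirror a b c k)"
      using word_eq_walk_crossing[OF eq] by simp
    also have "\<dots> = of_bool (height a b c (walk n \<Gamma> ?v (mirror a b c k)) < 0) -
        of_bool (height a b c (mirror a b c k) < 0)"
    proof (rule crossing_eq_height[OF t])
      show "fst ` set ?v \<subseteq> {a, b, c}"
        using w by (auto simp: translation_word_def)
    qed (auto simp: mirrors_def)
    also have "walk n \<Gamma> ?v (mirror a b c k) = mirror a b c (k - 2 * int i)"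
      using w walk_translation_word(2,3)[OF t]
      by (auto simp: walk_append walk_translation_power[OF t] walk_power_fixed)
    finally show ?thesis
      using k by (simp add: height_mirror[OF d]) 
  qed
  then have "(\<Sum>x\<in>?A. \<bar>crossing n \<Gamma> u x\<bar>) = int (2 * i)"
    using d by (subst sum.reindex) (auto simp: inj_on_def mirror_neq)
  moreover have "(\<Sum>x\<in>?A. \<bar>crossing n \<Gamma> u x\<bar>) \<le> int (length u)"
  proof (rule crossing_sum_le_length)
    show "- x \<notin> ?A" if "x \<in> ?A" for x
      using that mirror_neq(2)[OF d] by (metis imageE)
  qed simp
  ultimately show ?thesis by linarith
qed

end

context group
begin

text \<open>Since \<open>x\<close> and \<open>y\<close> are involutions, \<open>yxyx\<close> is the inverse of \<open>xyxy\<close>, which is its own inverse.\<close>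
lemma involution_relation_braid:
  assumes x: "x \<in> carrier G" "y \<in> carrier G" "x \<otimes> x = \<one>" "y \<otimes> y = \<one>"
    and "(x \<otimes> y) \<otimes> ((x \<otimes> y) \<otimes> ((x \<otimes> y) \<otimes> (x \<otimes> y))) = \<one>"
  shows "x \<otimes> (y \<otimes> (x \<otimes> y)) = y \<otimes> (x \<otimes> (y \<otimes> x))"
proof -
  let ?s = "x \<otimes> (y \<otimes> (x \<otimes> y))" and ?t = "y \<otimes> (x \<otimes> (y \<otimes> x))"
  have c: "x \<otimes> (x \<otimes> z) = z" "y \<otimes> (y \<otimes> z) = z" if "z \<in> carrier G" for z
    using that x by (simp_all add: m_assoc[symmetric])
  have "?s \<otimes> ?s = \<one>" using assms by (simp add: m_assoc)
  moreover have "?s \<otimes> ?t = \<one>" using x by (simp add: m_assoc c)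
  ultimately have "?s \<otimes> ?s = ?s \<otimes> ?t" by simp
  then show ?thesis using x by (metis m_closed Units_eq Units_l_cancel)
qed

text \<open>
  Each translation is a product of two reflections, and both \<open>xzx\<close> and \<open>y\<close> commute with both \<open>xyx\<close> and \<open>z\<close>: this is \<open>(x y)\<^sup>4 = 1\<close>, \<open>(x z)\<^sup>4 = 1\<close>, or
  \<open>y z = z y\<close>, possibly conjugated by \<open>x\<close>.
\<close>
lemma translations_commute:
  assumes x: "x \<in> carrier G" "y \<in> carrier G" "z \<in> carrier G"
    "x \<otimes> x = \<one>" "y \<otimes> y = \<one>" "z \<otimes> z = \<one>"
    and xy: "(x \<otimes> y) \<otimes> ((x \<otimes> y) \<otimes> ((x \<otimes> y) \<otimes> (x \<otimes> y))) = \<one>"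
    and xz: "(x \<otimes> z) \<otimes> ((x \<otimes> z) \<otimes> ((x \<otimes> z) \<otimes> (x \<otimes> z))) = \<one>"
    and yz: "(y \<otimes> z) \<otimes> (y \<otimes> z) = \<one>"
  shows "(x \<otimes> (z \<otimes> (x \<otimes> y))) \<otimes> (x \<otimes> (y \<otimes> (x \<otimes> z))) =
    (x \<otimes> (y \<otimes> (x \<otimes> z))) \<otimes> (x \<otimes> (z \<otimes> (x \<otimes> y)))"
proof -
  have c: "x \<otimes> (x \<otimes> w) = w" "y \<otimes> (y \<otimes> w) = w" "z \<otimes> (z \<otimes> w) = w" if "w \<in> carrier G" for w
    using that x by (simp_all add: m_assoc[symmetric])
  have comm: "y \<otimes> z = z \<otimes> y"
  proof -
    have "(y \<otimes> z) \<otimes> (z \<otimes> y) = \<one>" using x by (simp add: m_assoc c)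
    with yz have "(y \<otimes> z) \<otimes> (y \<otimes> z) = (y \<otimes> z) \<otimes> (z \<otimes> y)" by simp
    then show ?thesis using x by (metis m_closed Units_eq Units_l_cancel)
  qed
  have comm': "y \<otimes> (z \<otimes> w) = z \<otimes> (y \<otimes> w)" if "w \<in> carrier G" for w
    using that x comm by (metis m_assoc)
  have braid: "y \<otimes> (x \<otimes> (y \<otimes> (x \<otimes> w))) = x \<otimes> (y \<otimes> (x \<otimes> (y \<otimes> w)))"
    "z \<otimes> (x \<otimes> (z \<otimes> (x \<otimes> w))) = x \<otimes> (z \<otimes> (x \<otimes> (z \<otimes> w)))" if "w \<in> carrier G" for w
  proof -
    have "(y \<otimes> (x \<otimes> (y \<otimes> x))) \<otimes> w = (x \<otimes> (y \<otimes> (x \<otimes> y))) \<otimes> w"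
      using involution_relation_braid[of x y] x xy by simp
    moreover have "(z \<otimes> (x \<otimes> (z \<otimes> x))) \<otimes> w = (x \<otimes> (z \<otimes> (x \<otimes> z))) \<otimes> w"
      using involution_relation_braid[of x z] x xz by simp
    ultimately show "y \<otimes> (x \<otimes> (y \<otimes> (x \<otimes> w))) = x \<otimes> (y \<otimes> (x \<otimes> (y \<otimes> w)))"
      "z \<otimes> (x \<otimes> (z \<otimes> (x \<otimes> w))) = x \<otimes> (z \<otimes> (x \<otimes> (z \<otimes> w)))"
      using x that by (simp_all add: m_assoc)
  qed
  have "(x \<otimes> (z \<otimes> (x \<otimes> y))) \<otimes> (x \<otimes> (y \<otimes> (x \<otimes> z))) =
      x \<otimes> (z \<otimes> (x \<otimes> (y \<otimes> (x \<otimes> (y \<otimes> (x \<otimes> z))))))"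
    using x by (simp add: m_assoc)
  also have "\<dots> = x \<otimes> (z \<otimes> (y \<otimes> (x \<otimes> (y \<otimes> z))))"
    using x by (simp add: braid c)
  also have "\<dots> = x \<otimes> (y \<otimes> (z \<otimes> (x \<otimes> (z \<otimes> y))))"
    using x by (simp add: comm comm')
  also have "\<dots> = x \<otimes> (y \<otimes> (x \<otimes> (z \<otimes> (x \<otimes> (z \<otimes> (x \<otimes> y))))))"
    using x by (simp add: braid c)
  also have "\<dots> = (x \<otimes> (y \<otimes> (x \<otimes> z))) \<otimes> (x \<otimes> (z \<otimes> (x \<otimes> y)))"
    using x by (simp add: m_assoc)
  finally show ?thesis .
qed

end

definition word_length :: "'a set \<Rightarrow> 'a word set \<Rightarrow> 'a word set \<Rightarrow> nat" where
  "word_length S R A = (LEAST k. \<exists>u\<in>words S. word_class S R u = A \<and> length u = k)"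

lemma word_length_le: "u \<in> words S \<Longrightarrow> word_length S R (word_class S R u) \<le> length u"
  unfolding word_length_def by (rule Least_le) blast

lemma word_length_attained:
  assumes "A \<in> carrier (presented_group S R)"
  obtains u where "u \<in> words S" "word_class S R u = A" "length u = word_length S R A"
proof -
  have "\<exists>u\<in>words S. word_class S R u = A \<and> length u = word_length S R A"
    unfolding word_length_def
    by (rule LeastI_ex) (use assms in \<open>auto simp: carrier_presented_group\<close>)
  then show thesis using that by blast
qed

lemma one_presented_group: "\<one>\<^bsub>presented_group S R\<^esub> = word_class S R []"
  by (simp add: presented_group_def)

lemma word_length_one: "word_length S R \<one>\<^bsub>presented_group S R\<^esub> = 0"
  using word_length_le[of "[]" S R] by (simp add: one_presented_group)

lemma word_length_mult:
  assumes "A \<in> carrier (presented_group S R)" "B \<in> carrier (presented_group S R)"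
  shows "word_length S R (A \<otimes>\<^bsub>presented_group S R\<^esub> B) \<le> word_length S R A + word_length S R B"
proof -
  obtain u v where "u \<in> words S" "word_class S R u = A" "length u = word_length S R A"
    "v \<in> words S" "word_class S R v = B" "length v = word_length S R B"
    using assms word_length_attained by metis
  then show ?thesis
    using word_length_le[of "u @ v" S R] presented_group_mult[of u S v R] by auto
qed

lemma inv_word_class:
  assumes "u \<in> words S"
  shows "inv\<^bsub>presented_group S R\<^esub> (word_class S R u) =
    word_class S R (rev (map (\<lambda>(s, b). (s, \<not> b)) u))"
proof -
  interpret group "presented_group S R" by (rule group_presented_group)
  have w: "rev (map (\<lambda>(s, b). (s, \<not> b)) u) \<in> words S"
    using assms by (auto simp: words_def)
  show ?thesis
  proof (rule inv_equality)
    show "word_class S R (rev (map (\<lambda>(s, b). (s, \<not> b)) u)) \<otimes>\<^bsub>presented_group S R\<^esub> word_class S R u =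
        \<one>\<^bsub>presented_group S R\<^esub>"
      using assms w word_eq_inverse[OF assms, of R]
      by (simp add: presented_group_mult one_presented_group word_class_eq_iff)
  qed (use assms w in \<open>simp_all add: carrier_presented_group\<close>)
qed

lemma word_length_inv:
  assumes "A \<in> carrier (presented_group S R)"
  shows "word_length S R (inv\<^bsub>presented_group S R\<^esub> A) \<le> word_length S R A"
proof -
  obtain u where u: "u \<in> words S" "word_class S R u = A" "length u = word_length S R A"
    using assms word_length_attained by metis
  have "rev (map (\<lambda>(s, b). (s, \<not> b)) u) \<in> words S"
    using u by (auto simp: words_def)
  from word_length_le[OF this, of R] show ?thesis
    using u inv_word_class[OF u(1), of R] by simp
qed

lemma words_concat_replicate: "u \<in> words S \<Longrightarrow> concat (replicate i u) \<in> words S"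
  by (induction i) auto

lemma pow_word_class:
  assumes "u \<in> words S"
  shows "word_class S R u [^]\<^bsub>presented_group S R\<^esub> (i::nat) = word_class S R (concat (replicate i u))"
proof -
  interpret group "presented_group S R" by (rule group_presented_group)
  show ?thesis
  proof (induction i)
    case 0
    then show ?case by (simp add: one_presented_group)
  next
    case (Suc i)
    show ?case
      unfolding nat_pow_Suc Suc concat_replicate_Suc
      using assms words_concat_replicate[OF assms] by (simp add: presented_group_mult)
  qed
qed

text \<open>
  Word length with respect to all vertices is the length function for which the flat generated by the
  two translations is undistorted. The bound for powers of \<open>h\<close> alone is the one for \<open>g\<close> with \<open>b\<close> and
  \<open>c\<close> exchanged.
\<close>
lemma (in coxeter_rep) triangle_244_not_hyperbolic:
  assumes t: "triangle_244 n \<Gamma> a b c"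
  shows "\<not> hyperbolic_group (coxeter_group n \<Gamma>)"
proof -
  let ?S = "{..<n}" and ?R = "coxeter_relators n \<Gamma>"
  let ?G = "presented_group ?S ?R"
  interpret G: group ?G by (rule group_presented_group)
  let ?cl = "word_class ?S ?R"
  let ?N = "word_length ?S ?R"
  let ?s = "\<lambda>i. ?cl [(i, True)]"
  let ?g = "?cl (translation_word a b c)" and ?h = "?cl (translation_word a c b)"
  have abc: "a < n" "b < n" "c < n" using t by (auto simp: triangle_244_def)
  have gw: "translation_word a b c \<in> words ?S" and hw: "translation_word a c b \<in> words ?S"
    and rw: "rev (translation_word a c b) \<in> words ?S" 
    using abc by (simp_all add: translation_word_def)
  have sc: "?s i \<in> carrier ?G" if "i < n" for i
    using that by (simp add: carrier_presented_group)
  have rel: "?cl r = \<one>\<^bsub>?G\<^esub>" if "r \<in> ?R" "r \<in> words ?S" for r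
    using that word_eq.relator[of "[]" ?S "[]" r ?R]
    by (simp add: one_presented_group word_class_eq_iff)
  have sq: "?s i \<otimes>\<^bsub>?G\<^esub> ?s i = \<one>\<^bsub>?G\<^esub>" if "i < n" for i
    using rel[of "[(i, True), (i, True)]"] that
    by (auto simp: presented_group_mult coxeter_relators_def)
  have edge: "?cl (concat (replicate m [(i, True), (j, True)])) = \<one>\<^bsub>?G\<^esub>"
    if "i < n" "j < n" "i \<noteq> j" "\<Gamma> {i, j} = Some m" for i j m
    using that by (intro rel words_concat_replicate) (auto simp: coxeter_relators_def)
  have edge4: "(?s i \<otimes>\<^bsub>?G\<^esub> ?s j) \<otimes>\<^bsub>?G\<^esub>
      ((?s i \<otimes>\<^bsub>?G\<^esub> ?s j) \<otimes>\<^bsub>?G\<^esub> ((?s i \<otimes>\<^bsub>?G\<^esub> ?s j) \<otimes>\<^bsub>?G\<^esub> (?s i \<otimes>\<^bsub>?G\<^esub> ?s j))) = \<one>\<^bsub>?G\<^esub>"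
    if "i < n" "j < n" "i \<noteq> j" "\<Gamma> {i, j} = Some 4" for i j
    using edge[OF that] that by (simp add: presented_group_mult numeral_eq_Suc)
  have edge2: "(?s i \<otimes>\<^bsub>?G\<^esub> ?s j) \<otimes>\<^bsub>?G\<^esub> (?s i \<otimes>\<^bsub>?G\<^esub> ?s j) = \<one>\<^bsub>?G\<^esub>"
    if "i < n" "j < n" "i \<noteq> j" "\<Gamma> {i, j} = Some 2" for i j
    using edge[OF that] that by (simp add: presented_group_mult numeral_eq_Suc)
  have comm: "?g \<otimes>\<^bsub>?G\<^esub> ?h = ?h \<otimes>\<^bsub>?G\<^esub> ?g"
  proof -
    have "?g = ?s a \<otimes>\<^bsub>?G\<^esub> (?s c \<otimes>\<^bsub>?G\<^esub> (?s a \<otimes>\<^bsub>?G\<^esub> ?s b))"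
      "?h = ?s a \<otimes>\<^bsub>?G\<^esub> (?s b \<otimes>\<^bsub>?G\<^esub> (?s a \<otimes>\<^bsub>?G\<^esub> ?s c))"
      using abc by (simp_all add: presented_group_mult translation_word_def)
    then show ?thesis
      using G.translations_commute[of "?s a" "?s b" "?s c"] sc sq edge4 edge2 abc t
      by (simp add: triangle_244_def)
  qed
  have inv_h: "inv\<^bsub>?G\<^esub> ?h = ?cl (rev (translation_word a c b))"
  proof (rule G.inv_equality)
    have "?cl (rev (translation_word a c b)) \<otimes>\<^bsub>?G\<^esub> ?h =
      ?s c \<otimes>\<^bsub>?G\<^esub> (?s a \<otimes>\<^bsub>?G\<^esub> (?s b \<otimes>\<^bsub>?G\<^esub> (?s a \<otimes>\<^bsub>?G\<^esub>
        (?s a \<otimes>\<^bsub>?G\<^esub> (?s b \<otimes>\<^bsub>?G\<^esub> (?s a \<otimes>\<^bsub>?G\<^esub> ?s c))))))"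
      using abc by (simp add: presented_group_mult translation_word_def)
    also have "\<dots> = \<one>\<^bsub>?G\<^esub>"
    proof -
      have "?s i \<otimes>\<^bsub>?G\<^esub> (?s i \<otimes>\<^bsub>?G\<^esub> x) = x" if "i < n" "x \<in> carrier ?G" for i x
        using that sc sq by (simp add: G.m_assoc[symmetric])
      then show ?thesis using abc sc sq by simp
    qed
    finally show "?cl (rev (translation_word a c b)) \<otimes>\<^bsub>?G\<^esub> ?h = \<one>\<^bsub>?G\<^esub>" .
  qed (use hw rw in \<open>simp_all add: carrier_presented_group\<close>)
  have lower: "i \<le> ?N (?cl (concat (replicate i (translation_word a b c)) @ concat (replicate j w)))"
    if t: "triangle_244 n \<Gamma> a b c" and w: "w \<in> {translation_word a c b, rev (translation_word a c b)}"
    for a b c w i j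
  proof -
    let ?v = "concat (replicate i (translation_word a b c)) @ concat (replicate j w)"
    have abc: "a < n" "b < n" "c < n" using t by (auto simp: triangle_244_def)
    then have v: "?v \<in> words ?S"
      using w by (auto simp: translation_word_def intro!: words_concat_replicate)
    then have "?cl ?v \<in> carrier ?G" by (simp add: carrier_presented_group)
    then obtain u where u: "u \<in> words ?S" "?cl u = ?cl ?v" "length u = ?N (?cl ?v)"
      using word_length_attained by blast
    then have "word_eq ?S ?R ?v u" using v by (metis word_class_eq_iff)
    from translation_length[OF t w this] show ?thesis using u by simp
  qed
  show ?thesis
    unfolding coxeter_group_def
  proof (rule not_hyperbolic_if_undistorted_flat[where N = ?N and g = ?g and h = ?h])
    show "i \<le> ?N (?g [^]\<^bsub>?G\<^esub> i \<otimes>\<^bsub>?G\<^esub> ?h [^]\<^bsub>?G\<^esub> j)" for i j :: nat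
      using lower[OF t, of "translation_word a c b" i j] gw hw
      by (simp add: pow_word_class presented_group_mult words_concat_replicate)
    show "i \<le> ?N (?g [^]\<^bsub>?G\<^esub> i \<otimes>\<^bsub>?G\<^esub> inv\<^bsub>?G\<^esub> (?h [^]\<^bsub>?G\<^esub> j))" for i j :: nat
    proof -
      have "inv\<^bsub>?G\<^esub> (?h [^]\<^bsub>?G\<^esub> j) = (inv\<^bsub>?G\<^esub> ?h) [^]\<^bsub>?G\<^esub> j"
        using hw by (intro G.nat_pow_inv[symmetric]) (simp add: carrier_presented_group)
      then show ?thesis
        using lower[OF t, of "rev (translation_word a c b)" i j] gw rw
        by (simp add: inv_h pow_word_class presented_group_mult words_concat_replicate)
    qed
    show "j \<le> ?N (?h [^]\<^bsub>?G\<^esub> j)" for j :: nat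
      using lower[OF triangle_244_swap[OF t], of "translation_word a b c" j 0] hw
      by (simp add: pow_word_class)
  qed (use gw hw comm in \<open>auto simp: carrier_presented_group group_presented_group word_length_one
      intro: word_length_mult word_length_inv\<close>)
qed

section \<open>Triangles in the random graph\<close>

text \<open>If no event occurs, the number of events that occur differs from its mean \<open>\<mu>\<close> by \<open>\<mu>\<close>; this is
  bounded by Chebyshev's inequality.\<close>
lemma second_moment_avoid:
  fixes M :: "'a pmf" and Ev :: "'t \<Rightarrow> 'a set"
  assumes T: "finite T"
  defines "\<mu> \<equiv> (\<Sum>t\<in>T. measure_pmf.prob M (Ev t))"
    and "\<nu> \<equiv> (\<Sum>t\<in>T. \<Sum>u\<in>T. measure_pmf.prob M (Ev t \<inter> Ev u))"
  assumes pos: "0 < \<mu>"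
  shows "measure_pmf.prob M {x. \<forall>t\<in>T. x \<notin> Ev t} \<le> (\<nu> - \<mu>\<^sup>2) / \<mu>\<^sup>2"
proof -
  define X :: "'a \<Rightarrow> real" where "X = (\<lambda>x. \<Sum>t\<in>T. indicator (Ev t) x)"
  have int: "integrable (measure_pmf M) (indicator A :: 'a \<Rightarrow> real)" for A
    by (intro integrable_real_indicator) (auto simp: measure_pmf.emeasure_eq_measure)
  have sq: "X x ^ 2 = (\<Sum>t\<in>T. \<Sum>u\<in>T. indicator (Ev t \<inter> Ev u) x)" for x
    unfolding X_def power2_eq_square sum_product by (simp add: indicator_inter_arith)
  have EX: "measure_pmf.expectation M X = \<mu>"
    unfolding X_def \<mu>_def using int by (subst Bochner_Integration.integral_sum) auto
  have EX2: "measure_pmf.expectation M (\<lambda>x. X x ^ 2) = \<nu>"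
    unfolding sq \<nu>_def using int by (simp add: Bochner_Integration.integral_sum)
  have intX: "integrable (measure_pmf M) X"
    unfolding X_def using int by (intro Bochner_Integration.integrable_sum) auto
  have intX2: "integrable (measure_pmf M) (\<lambda>x. X x ^ 2)"
    unfolding sq using int by (intro Bochner_Integration.integrable_sum) auto
  have "measure_pmf.prob M {x. \<forall>t\<in>T. x \<notin> Ev t} \<le>
      measure_pmf.prob M {x \<in> space (measure_pmf M). \<bar>X x - measure_pmf.expectation M X\<bar> \<ge> \<mu>}"
    using pos by (intro measure_pmf.finite_measure_mono) (auto simp: X_def EX[unfolded X_def])
  also have "\<dots> \<le> measure_pmf.variance M X / \<mu>\<^sup>2"
    using pos intX2 by (intro measure_pmf.Chebyshev_inequality) auto
  also have "measure_pmf.variance M X = \<nu> - \<mu>\<^sup>2"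
    using intX intX2 by (subst measure_pmf.variance_eq) (simp_all add: EX EX2)
  finally show ?thesis .
qed

lemma prob_random_graph_edges:
  assumes p: "label_probabilities p" and K: "K \<subseteq> vertex_pairs n" and lab: "\<And>e. e \<in> K \<Longrightarrow> 2 \<le> lab e"
  shows "measure_pmf.prob (random_graph p n) {\<Gamma>. \<forall>e\<in>K. \<Gamma> e = Some (lab e)} = (\<Prod>e\<in>K. p (lab e) n)"
proof -
  let ?B = "\<lambda>e. if e \<in> K then {Some (lab e)} else UNIV"
  have "{\<Gamma>. \<forall>e\<in>K. \<Gamma> e = Some (lab e)} = Pi (vertex_pairs n) ?B"
    using K by (auto simp: Pi_def)
  then have "measure_pmf.prob (random_graph p n) {\<Gamma>. \<forall>e\<in>K. \<Gamma> e = Some (lab e)} =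
      (\<Prod>e\<in>vertex_pairs n. measure_pmf.prob (edge_label_pmf p n) (?B e))"
    unfolding random_graph_def by (simp add: measure_Pi_pmf_Pi finite_vertex_pairs)
  also have "\<dots> = (\<Prod>e\<in>K. p (lab e) n)"
    using K lab finite_vertex_pairs
    by (intro prod.mono_neutral_cong_right) (auto simp: measure_pmf_single pmf_edge_label_pmf[OF p])
  finally show ?thesis .
qed

text \<open>
  Only triangles with one vertex in each of three disjoint intervals are counted. The vertex with
  two sides labelled 4 comes from the first interval, so a side determines its label, and two
  triangles share a side exactly if they agree in two coordinates.
\<close>
definition tripartite :: "nat \<Rightarrow> (nat \<times> nat \<times> nat) set" where
  "tripartite m = {..<m} \<times> {m..<2 * m} \<times> {2 * m..<3 * m}"

fun sides :: "nat \<times> nat \<times> nat \<Rightarrow> nat set set" where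
  "sides (a, b, c) = {{a, b}, {a, c}, {b, c}}"

definition side_label :: "nat \<Rightarrow> nat set \<Rightarrow> nat" where
  "side_label m e = (if e \<inter> {..<m} = {} then 2 else 4)"

lemma finite_tripartite: "finite (tripartite m)"
  by (simp add: tripartite_def)

lemma card_tripartite: "card (tripartite m) = m ^ 3"
  by (simp add: tripartite_def card_cartesian_product power3_eq_cube)

lemma sides_vertex_pairs:
  assumes "t \<in> tripartite m" "3 * m \<le> n"
  shows "sides t \<subseteq> vertex_pairs n"
  using assms by (auto simp: tripartite_def vertex_pairs_def)

lemma prod_sides:
  assumes "t \<in> tripartite m"
  shows "(\<Prod>e\<in>sides t. p (side_label m e) n) = p 4 n * p 4 n * (p 2 n :: real)"
proof -
  obtain a b c where t: "t = (a, b, c)" "a < m" "m \<le> b" "b < 2 * m" "2 * m \<le> c" "c < 3 * m"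
    using assms by (auto simp: tripartite_def)
  have "side_label m {a, b} = 4" "side_label m {a, c} = 4" "side_label m {b, c} = 2"
    using t by (auto simp: side_label_def)
  moreover have "{a, b} \<noteq> {a, c}" "{a, b} \<noteq> {b, c}" "{a, c} \<noteq> {b, c}"
    using t by (auto simp: doubleton_eq_iff)
  ultimately show ?thesis using t(1) by simp
qed

lemma prod_new_sides:
  assumes t: "(a, b, c) \<in> tripartite m" and u: "(a', b', c') \<in> tripartite m"
  shows "(\<Prod>e\<in>sides (a', b', c') - sides (a, b, c). p (side_label m e) n) =
    (if a' = a \<and> b' = b then 1 else p 4 n) * (if a' = a \<and> c' = c then 1 else p 4 n) *
    (if b' = b \<and> c' = c then 1 else p 2 n :: real)"
proof -
  have *: "a < m" "m \<le> b" "b < 2 * m" "2 * m \<le> c" "c < 3 * m"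
    "a' < m" "m \<le> b'" "b' < 2 * m" "2 * m \<le> c'" "c' < 3 * m"
    using t u by (auto simp: tripartite_def)
  have lab: "side_label m {a', b'} = 4" "side_label m {a', c'} = 4" "side_label m {b', c'} = 2"
    using * by (auto simp: side_label_def)
  have ne: "{a', b'} \<noteq> {a', c'}" "{a', b'} \<noteq> {b', c'}" "{a', c'} \<noteq> {b', c'}"
    using * by (auto simp: doubleton_eq_iff)
  have mem: "{a', b'} \<in> sides (a, b, c) \<longleftrightarrow> a' = a \<and> b' = b"
    "{a', c'} \<in> sides (a, b, c) \<longleftrightarrow> a' = a \<and> c' = c"
    "{b', c'} \<in> sides (a, b, c) \<longleftrightarrow> b' = b \<and> c' = c"
    using * by (auto simp: doubleton_eq_iff)
  have "(\<Prod>e\<in>sides (a', b', c') - sides (a, b, c). p (side_label m e) n) =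
      (\<Prod>e\<in>sides (a', b', c'). if e \<in> sides (a, b, c) then 1 else p (side_label m e) n)"
    by (intro prod.mono_neutral_cong_left) auto
  also have "\<dots> = (if {a', b'} \<in> sides (a, b, c) then 1 else p (side_label m {a', b'}) n) *
      (if {a', c'} \<in> sides (a, b, c) then 1 else p (side_label m {a', c'}) n) *
      (if {b', c'} \<in> sides (a, b, c) then 1 else p (side_label m {b', c'}) n)"
    using ne by (simp del: sides.simps add: sides.simps[of a' b' c'])
  finally show ?thesis by (simp only: mem lab)
qed

text \<open>
  The four terms account for the triangles that share no side with \<open>t\<close>, a side labelled 4, the side
  labelled 2, or all sides. Sharing exactly two sides is impossible, as these already contain all three
  vertices.
\<close>
lemma sum_new_sides:
  assumes p: "0 \<le> p 4 n" "0 \<le> (p 2 n :: real)" and t: "t \<in> tripartite m"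
  shows "(\<Sum>u\<in>tripartite m. \<Prod>e\<in>sides u - sides t. p (side_label m e) n) \<le>
    real m ^ 3 * (p 4 n * p 4 n * p 2 n) + 2 * real m * (p 4 n * p 2 n) + real m * (p 4 n * p 4 n) + 1"
proof -
  obtain a b c where abc: "t = (a, b, c)" by (cases t)
  let ?x = "p 4 n" and ?y = "p 2 n"
  let ?A = "{..<m}" and ?B = "{m..<2 * m}" and ?C = "{2 * m..<3 * m}"
  have mem: "a \<in> ?A" "b \<in> ?B" "c \<in> ?C" using t by (auto simp: abc tripartite_def)
  have "(\<Sum>u\<in>tripartite m. \<Prod>e\<in>sides u - sides t. p (side_label m e) n) \<le>
    (\<Sum>(a', b', c')\<in>tripartite m. ?x * ?x * ?y + of_bool (a' = a \<and> b' = b) * (?x * ?y) +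
      of_bool (a' = a \<and> c' = c) * (?x * ?y) + of_bool (b' = b \<and> c' = c) * (?x * ?x) +
      of_bool (a' = a \<and> b' = b \<and> c' = c))"
  proof (rule sum_mono)
    fix u assume u: "u \<in> tripartite m"
    obtain a' b' c' where u': "u = (a', b', c')" by (cases u)
    show "(\<Prod>e\<in>sides u - sides t. p (side_label m e) n) \<le> (case u of (a', b', c') \<Rightarrow>
      ?x * ?x * ?y + of_bool (a' = a \<and> b' = b) * (?x * ?y) +
      of_bool (a' = a \<and> c' = c) * (?x * ?y) + of_bool (b' = b \<and> c' = c) * (?x * ?x) +
      of_bool (a' = a \<and> b' = b \<and> c' = c))"
      using p prod_new_sides[of a b c m a' b' c' p n] u t
      by (auto simp: u' abc)
  qed
  also have "\<dots> = (\<Sum>a'\<in>?A. \<Sum>b'\<in>?B. \<Sum>c'\<in>?C.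
      ?x * ?x * ?y + of_bool (a' = a \<and> b' = b) * (?x * ?y) +
      of_bool (a' = a \<and> c' = c) * (?x * ?y) + of_bool (b' = b \<and> c' = c) * (?x * ?x) +
      of_bool (a' = a \<and> b' = b \<and> c' = c))"
    by (simp add: tripartite_def sum.cartesian_product)
  also have "\<dots> = real m ^ 3 * (?x * ?x * ?y) + 2 * real m * (?x * ?y) + real m * (?x * ?x) + 1"
  proof -
    have pick: "(\<Sum>i\<in>I. of_bool (i = j \<and> P i) * r) = (if j \<in> I \<and> P j then r else 0)"
      if "finite I" for I :: "nat set" and j P and r :: real
    proof -
      have "(\<Sum>i\<in>I. of_bool (i = j \<and> P i) * r) = (\<Sum>i\<in>I. if i = j then (if P j then r else 0) else 0)"
        by (intro sum.cong) auto
      then show ?thesis using that by simp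
    qed
    have fin: "finite ?A" "finite ?B" "finite ?C" by auto
    have s1: "(\<Sum>a'\<in>?A. \<Sum>b'\<in>?B. \<Sum>c'\<in>?C. ?x * ?x * ?y) = real m ^ 3 * (?x * ?x * ?y)"
      by (simp add: power3_eq_cube algebra_simps)
    have s2: "(\<Sum>a'\<in>?A. \<Sum>b'\<in>?B. \<Sum>c'\<in>?C. of_bool (a' = a \<and> b' = b) * r) = real m * r" for r :: real
    proof -
      have "(\<Sum>a'\<in>?A. \<Sum>b'\<in>?B. \<Sum>c'\<in>?C. of_bool (a' = a \<and> b' = b) * r) =
          (\<Sum>a'\<in>?A. of_bool (a' = a \<and> True) * (\<Sum>b'\<in>?B. of_bool (b' = b \<and> True) * (real m * r)))"
        unfolding sum_distrib_left by (intro sum.cong refl) auto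
      then show ?thesis using mem by (simp only: pick fin) simp
    qed
    have s3: "(\<Sum>a'\<in>?A. \<Sum>b'\<in>?B. \<Sum>c'\<in>?C. of_bool (a' = a \<and> c' = c) * r) = real m * r" for r :: real
    proof -
      have "(\<Sum>a'\<in>?A. \<Sum>b'\<in>?B. \<Sum>c'\<in>?C. of_bool (a' = a \<and> c' = c) * r) =
          (\<Sum>a'\<in>?A. of_bool (a' = a \<and> True) * (\<Sum>b'\<in>?B. \<Sum>c'\<in>?C. of_bool (c' = c \<and> True) * r))"
        unfolding sum_distrib_left by (intro sum.cong refl) auto
      then show ?thesis using mem by (simp only: pick fin) simp
    qed
    have s4: "(\<Sum>a'\<in>?A. \<Sum>b'\<in>?B. \<Sum>c'\<in>?C. of_bool (b' = b \<and> c' = c) * r) = real m * r" for r :: real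
    proof -
      have "(\<Sum>a'\<in>?A. \<Sum>b'\<in>?B. \<Sum>c'\<in>?C. of_bool (b' = b \<and> c' = c) * r) =
          (\<Sum>a'\<in>?A. \<Sum>b'\<in>?B. of_bool (b' = b \<and> True) * (\<Sum>c'\<in>?C. of_bool (c' = c \<and> True) * r))"
        unfolding sum_distrib_left by (intro sum.cong refl) auto
      then show ?thesis using mem by (simp only: pick fin) simp
    qed
    have s5: "(\<Sum>a'\<in>?A. \<Sum>b'\<in>?B. \<Sum>c'\<in>?C. of_bool (a' = a \<and> b' = b \<and> c' = c)) = (1 :: real)"
    proof -
      have "(\<Sum>a'\<in>?A. \<Sum>b'\<in>?B. \<Sum>c'\<in>?C. of_bool (a' = a \<and> b' = b \<and> c' = c)) =
          (\<Sum>a'\<in>?A. of_bool (a' = a \<and> True) * (\<Sum>b'\<in>?B. of_bool (b' = b \<and> True) *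
            (\<Sum>c'\<in>?C. of_bool (c' = c \<and> True) * (1 :: real))))"
        unfolding sum_distrib_left by (intro sum.cong refl) auto
      then show ?thesis using mem by (simp only: pick fin) simp
    qed
    show ?thesis
      by (simp only: sum.distrib s1 s2 s3 s4 s5)
  qed
  finally show ?thesis .
qed

definition triangle_event :: "nat \<Rightarrow> nat \<times> nat \<times> nat \<Rightarrow> labelled_graph set" where
  "triangle_event m t = {\<Gamma>. \<forall>e\<in>sides t. \<Gamma> e = Some (side_label m e)}"

lemma triangle_event_triangle_244:
  assumes "t \<in> tripartite m" "3 * m \<le> n" "\<Gamma> \<in> triangle_event m t"
  shows "\<exists>a b c. triangle_244 n \<Gamma> a b c"
proof -
  obtain a b c where t: "t = (a, b, c)" "a < m" "m \<le> b" "b < 2 * m" "2 * m \<le> c" "c < 3 * m"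
    using assms(1) by (auto simp: tripartite_def)
  have "side_label m {a, b} = 4" "side_label m {a, c} = 4" "side_label m {b, c} = 2"
    using t by (auto simp: side_label_def)
  then have "triangle_244 n \<Gamma> a b c"
    using assms t by (auto simp: triangle_event_def triangle_244_def)
  then show ?thesis by blast
qed

text \<open>
  The first summand of \<open>sum_new_sides\<close> reproduces the square of the mean, so the variance is at
  most the mean times the remaining three summands, and each of these gives one of the terms below.
\<close>
lemma prob_no_triangle_244:
  assumes p: "label_probabilities p" and pos: "0 < p 4 n" "0 < p 2 n" and m: "0 < m" "3 * m \<le> n"
  shows "measure_pmf.prob (random_graph p n) {\<Gamma>. \<not> (\<exists>a b c. triangle_244 n \<Gamma> a b c)} \<le>
    2 / (real m ^ 2 * p 4 n) + 1 / (real m ^ 2 * p 2 n) + 1 / (real m ^ 3 * p 4 n ^ 2 * p 2 n)"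
proof -
  let ?P = "measure_pmf.prob (random_graph p n)" and ?T = "tripartite m" and ?Ev = "triangle_event m"
  let ?x = "p 4 n" and ?y = "p 2 n"
  define q where "q = ?x * ?x * ?y"
  define r where "r = 2 * real m * (?x * ?y) + real m * (?x * ?x) + 1"
  have q: "0 < q" using pos by (simp add: q_def)
  have lab: "2 \<le> side_label m e" for e by (simp add: side_label_def)
  have single: "?P (?Ev t) = q" if "t \<in> ?T" for t
    unfolding triangle_event_def
    using prob_random_graph_edges[OF p sides_vertex_pairs[OF that m(2)], of "side_label m"] prod_sides[OF that] lab
    by (simp add: q_def)
  have \<mu>: "(\<Sum>t\<in>?T. ?P (?Ev t)) = real m ^ 3 * q"
    using single by (simp add: card_tripartite)
  have pair: "?P (?Ev t \<inter> ?Ev u) = q * (\<Prod>e\<in>sides u - sides t. p (side_label m e) n)"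
    if "t \<in> ?T" "u \<in> ?T" for t u
  proof -
    have fin: "finite (sides t)" "finite (sides u)" by (cases t; cases u; simp)+
    have "?Ev t \<inter> ?Ev u = {\<Gamma>. \<forall>e\<in>sides t \<union> sides u. \<Gamma> e = Some (side_label m e)}"
      by (auto simp: triangle_event_def)
    then have "?P (?Ev t \<inter> ?Ev u) = (\<Prod>e\<in>sides t \<union> sides u. p (side_label m e) n)"
      using prob_random_graph_edges[OF p, of "sides t \<union> sides u" n "side_label m"]
        sides_vertex_pairs[OF _ m(2)] that lab by simp
    also have "sides t \<union> sides u = sides t \<union> (sides u - sides t)" by auto
    also have "(\<Prod>e\<in>sides t \<union> (sides u - sides t). p (side_label m e) n) =
        (\<Prod>e\<in>sides t. p (side_label m e) n) * (\<Prod>e\<in>sides u - sides t. p (side_label m e) n)"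
      using fin by (intro prod.union_disjoint) auto
    finally show ?thesis using prod_sides[OF that(1), of p n] by (simp add: q_def)
  qed
  have \<nu>: "(\<Sum>t\<in>?T. \<Sum>u\<in>?T. ?P (?Ev t \<inter> ?Ev u)) \<le> real m ^ 3 * (q * (real m ^ 3 * q + r))"
  proof -
    have "(\<Sum>u\<in>?T. ?P (?Ev t \<inter> ?Ev u)) \<le> q * (real m ^ 3 * q + r)" if t: "t \<in> ?T" for t
    proof -
      have "(\<Sum>u\<in>?T. ?P (?Ev t \<inter> ?Ev u)) =
          q * (\<Sum>u\<in>?T. \<Prod>e\<in>sides u - sides t. p (side_label m e) n)"
        using pair t by (simp add: sum_distrib_left)
      also have "\<dots> \<le> q * (real m ^ 3 * q + r)"
        using sum_new_sides[OF _ _ t, of p n] pos q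
        by (intro mult_left_mono) (auto simp: q_def r_def algebra_simps)
      finally show ?thesis .
    qed
    then have "(\<Sum>t\<in>?T. \<Sum>u\<in>?T. ?P (?Ev t \<inter> ?Ev u)) \<le> (\<Sum>t\<in>?T. q * (real m ^ 3 * q + r))"
      by (rule sum_mono)
    then show ?thesis by (simp add: card_tripartite)
  qed
  have "?P {\<Gamma>. \<not> (\<exists>a b c. triangle_244 n \<Gamma> a b c)} \<le> ?P {\<Gamma>. \<forall>t\<in>?T. \<Gamma> \<notin> ?Ev t}"
  proof (rule measure_pmf.finite_measure_mono)
    show "{\<Gamma>. \<not> (\<exists>a b c. triangle_244 n \<Gamma> a b c)} \<subseteq> {\<Gamma>. \<forall>t\<in>?T. \<Gamma> \<notin> ?Ev t}"
      using triangle_event_triangle_244[OF _ m(2)] by blast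
  qed simp
  also have "\<dots> \<le> ((\<Sum>t\<in>?T. \<Sum>u\<in>?T. ?P (?Ev t \<inter> ?Ev u)) - (real m ^ 3 * q)\<^sup>2) / (real m ^ 3 * q)\<^sup>2"
    using second_moment_avoid[OF finite_tripartite, of "random_graph p n" ?Ev m] q m(1)
    unfolding \<mu> by simp
  also have "\<dots> \<le> (real m ^ 3 * (q * (real m ^ 3 * q + r)) - (real m ^ 3 * q)\<^sup>2) / (real m ^ 3 * q)\<^sup>2"
    using \<nu> by (intro divide_right_mono) auto
  also have "\<dots> = r / (real m ^ 3 * q)"
    using q m(1) by (simp add: power2_eq_square field_simps)
  also have "\<dots> = 2 / (real m ^ 2 * ?x) + 1 / (real m ^ 2 * ?y) + 1 / (real m ^ 3 * ?x ^ 2 * ?y)"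
    using pos m(1) by (simp add: r_def q_def power2_eq_square power3_eq_cube field_simps)
  finally show ?thesis .
qed

lemma prob_no_triangle_244_scaled:
  assumes p: "label_probabilities p" and n: "4 \<le> n" and c: "0 < c" "c \<le> real n * p 2 n"
    and K: "0 < K" "K \<le> real n * p 4 n"
  shows "measure_pmf.prob (random_graph p n) {\<Gamma>. \<not> (\<exists>a b c. triangle_244 n \<Gamma> a b c)} \<le>
    72 / K + 36 / (c * real n) + 216 / (K ^ 2 * c)"
proof -
  define m where "m = n div 3"
  have m: "0 < m" "3 * m \<le> n" "real n \<le> 6 * real m"
    using n by (auto simp: m_def)
  let ?x = "p 4 n" and ?y = "p 2 n"
  have "0 < real n * ?x" "0 < real n * ?y" using c K by linarith+
  then have pos: "0 < ?x" "0 < ?y" by (auto simp: zero_less_mult_iff)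
  have N: "1 \<le> real n" using n by simp
  have Kx: "K \<le> 6 * real m * ?x"
    using K(2) mult_right_mono[OF m(3) less_imp_le[OF pos(1)]] by linarith
  have cy: "c \<le> 6 * real m * ?y"
    using c(2) mult_right_mono[OF m(3) less_imp_le[OF pos(2)]] by linarith
  have "K \<le> 36 * (real m ^ 2 * ?x)"
  proof -
    have "K * 1 \<le> (6 * real m * ?x) * (6 * real m)" using Kx m N K by (intro mult_mono) auto
    then show ?thesis by (simp add: power2_eq_square algebra_simps)
  qed
  then have 1: "2 / (real m ^ 2 * ?x) \<le> 72 / K"
    using K pos m(1) by (simp add: field_simps)
  have "c * real n \<le> 36 * (real m ^ 2 * ?y)"
  proof -
    have "c * real n \<le> (6 * real m * ?y) * (6 * real m)" using cy m c by (intro mult_mono) auto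
    then show ?thesis by (simp add: power2_eq_square algebra_simps)
  qed
  then have 2: "1 / (real m ^ 2 * ?y) \<le> 36 / (c * real n)"
    using c pos m(1) N by (simp add: field_simps)
  have "K ^ 2 * c \<le> 216 * (real m ^ 3 * ?x ^ 2 * ?y)"
  proof -
    have "K ^ 2 * c \<le> (6 * real m * ?x) ^ 2 * (6 * real m * ?y)"
      using Kx cy K c by (intro mult_mono power_mono) auto
    then show ?thesis by (simp add: power2_eq_square power3_eq_cube algebra_simps)
  qed
  then have 3: "1 / (real m ^ 3 * ?x ^ 2 * ?y) \<le> 216 / (K ^ 2 * c)"
    using K c pos m(1) by (simp add: field_simps)
  show ?thesis
    using prob_no_triangle_244[OF p pos m(1,2)] 1 2 3 by linarith
qed

lemma random_graph_label_ge_2: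
  assumes p: "label_probabilities p" and \<Gamma>: "\<Gamma> \<in> set_pmf (random_graph p n)"
    and e: "e \<in> vertex_pairs n" "\<Gamma> e = Some m"
  shows "2 \<le> m"
proof -
  have "\<Gamma> e \<in> set_pmf (edge_label_pmf p n)"
    using \<Gamma> e(1) set_Pi_pmf_subset'[OF finite_vertex_pairs, of n None "\<lambda>_. edge_label_pmf p n"]
    by (auto simp: random_graph_def PiE_dflt_def)
  then show ?thesis
    using e(2) by (auto simp: set_pmf_iff pmf_edge_label_pmf[OF p] split: if_splits)
qed

lemma prob_not_hyperbolic_ge:
  assumes p: "label_probabilities p"
  shows "1 - measure_pmf.prob (random_graph p n) {\<Gamma>. \<not> (\<exists>a b c. triangle_244 n \<Gamma> a b c)} \<le>
    measure_pmf.prob (random_graph p n) {\<Gamma>. \<not> hyperbolic_group (coxeter_group n \<Gamma>)}"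
proof -
  let ?P = "measure_pmf.prob (random_graph p n)"
  have "1 - ?P {\<Gamma>. \<not> (\<exists>a b c. triangle_244 n \<Gamma> a b c)} = ?P {\<Gamma>. \<exists>a b c. triangle_244 n \<Gamma> a b c}"
    using measure_pmf.prob_compl[of "{\<Gamma>. \<not> (\<exists>a b c. triangle_244 n \<Gamma> a b c)}" "random_graph p n"]
    by (simp add: Compl_eq_Diff_UNIV[symmetric] Collect_neg_eq[symmetric])
  also have "\<dots> = ?P ({\<Gamma>. \<exists>a b c. triangle_244 n \<Gamma> a b c} \<inter> set_pmf (random_graph p n))"
    by (simp add: measure_Int_set_pmf)
  also have "\<dots> \<le> ?P {\<Gamma>. \<not> hyperbolic_group (coxeter_group n \<Gamma>)}"
  proof (rule measure_pmf.finite_measure_mono)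
    show "{\<Gamma>. \<exists>a b c. triangle_244 n \<Gamma> a b c} \<inter> set_pmf (random_graph p n) \<subseteq>
        {\<Gamma>. \<not> hyperbolic_group (coxeter_group n \<Gamma>)}"
    proof
      fix \<Gamma> assume "\<Gamma> \<in> {\<Gamma>. \<exists>a b c. triangle_244 n \<Gamma> a b c} \<inter> set_pmf (random_graph p n)"
      then obtain a b c where t: "triangle_244 n \<Gamma> a b c" and \<Gamma>: "\<Gamma> \<in> set_pmf (random_graph p n)"
        by auto
      interpret coxeter_rep n \<Gamma>
      proof
        fix i j m assume "i < n" "j < n" "i \<noteq> j" "\<Gamma> {i, j} = Some m"
        then show "2 \<le> m"
          by (intro random_graph_label_ge_2[OF p \<Gamma>, of "{i, j}"]) (auto simp: vertex_pairs_def)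
      qed
      show "\<Gamma> \<in> {\<Gamma>. \<not> hyperbolic_group (coxeter_group n \<Gamma>)}"
        using triangle_244_not_hyperbolic[OF t] by simp
    qed
  qed simp
  finally show ?thesis .
qed

text \<open>
  A sequence of sizes \<open>r\<close> serves both parts of the conclusion: the identity if \<open>n p\<^sub>2\<close> is
  eventually bounded away from 0, and otherwise an enumeration of those \<open>n\<close> for which it is.
\<close>
lemma prob_not_hyperbolic_tendsto:
  fixes p :: "nat \<Rightarrow> nat \<Rightarrow> real"
  assumes p: "label_probabilities p"
    and p4: "filterlim (\<lambda>n. real n * p 4 n) at_top sequentially"
    and r: "filterlim r at_top sequentially"
    and c: "0 < c" and p2: "eventually (\<lambda>k. c \<le> real (r k) * p 2 (r k)) sequentially"
  shows "(\<lambda>k. measure_pmf.prob (random_graph p (r k))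
    {\<Gamma>. \<not> hyperbolic_group (coxeter_group (r k) \<Gamma>)}) \<longlonglongrightarrow> 1"
proof -
  define K where "K k = real (r k) * p 4 (r k)" for k
  have K: "filterlim K at_top sequentially"
    unfolding K_def using filterlim_compose[OF p4 r] .
  have R: "filterlim (\<lambda>k. c * real (r k)) at_top sequentially"
    using c filterlim_compose[OF filterlim_real_sequentially r]
    by (intro filterlim_tendsto_pos_mult_at_top[OF tendsto_const]) auto
  have K2: "filterlim (\<lambda>k. K k ^ 2 * c) at_top sequentially"
    using c by (subst mult.commute)
      (intro filterlim_tendsto_pos_mult_at_top[OF tendsto_const] filterlim_pow_at_top K; simp)
  let ?b = "\<lambda>k. 72 / K k + 36 / (c * real (r k)) + 216 / (K k ^ 2 * c)"
  have "(\<lambda>k. 1 - ?b k) \<longlonglongrightarrow> 1 - (0 + 0 + 0)"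
    by (intro tendsto_intros real_tendsto_divide_at_top[OF tendsto_const] K R K2)
  then have lim: "(\<lambda>k. 1 - ?b k) \<longlonglongrightarrow> 1" by simp
  have "eventually (\<lambda>k. 1 - ?b k \<le> measure_pmf.prob (random_graph p (r k))
    {\<Gamma>. \<not> hyperbolic_group (coxeter_group (r k) \<Gamma>)}) sequentially"
    using p2 filterlim_at_top_dense[THEN iffD1, OF K, rule_format, of 0]
      filterlim_at_top[THEN iffD1, OF r, rule_format, of 4]
  proof eventually_elim
    case (elim k)
    have "measure_pmf.prob (random_graph p (r k)) {\<Gamma>. \<not> (\<exists>a b e. triangle_244 (r k) \<Gamma> a b e)} \<le> ?b k"
      using prob_no_triangle_244_scaled[OF p, of "r k" c "K k"] elim c by (simp add: K_def)
    then show ?case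
      using prob_not_hyperbolic_ge[OF p, of "r k"] by linarith
  qed
  then show ?thesis
    by (rule tendsto_sandwich[OF _ _ lim tendsto_const]) simp
qed

theorem theorem8:
  fixes p :: "nat \<Rightarrow> nat \<Rightarrow> real"
  assumes "label_probabilities p"
    and "filterlim (\<lambda>n. real n * p 4 n) at_top sequentially"
    and "\<not> (\<lambda>n. real n * p 2 n) \<longlonglongrightarrow> 0"
  shows "(0 < liminf (\<lambda>n. ereal (real n * p 2 n)) \<longrightarrow>
      (\<lambda>n. measure_pmf.prob (random_graph p n)
        {\<Gamma>. \<not> hyperbolic_group (coxeter_group n \<Gamma>)}) \<longlonglongrightarrow> 1) \<and>
    (\<exists>r. strict_mono r \<and>
      (\<lambda>k. measure_pmf.prob (random_graph p (r k))
        {\<Gamma>. \<not> hyperbolic_group (coxeter_group (r k) \<Gamma>)}) \<longlonglongrightarrow> 1)"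
proof (intro conjI impI)
  assume "0 < liminf (\<lambda>n. ereal (real n * p 2 n))"
  then obtain c where c: "0 < ereal c" "ereal c < liminf (\<lambda>n. ereal (real n * p 2 n))"
    using ereal_dense2 by blast
  from less_LiminfD[OF c(2)] have "eventually (\<lambda>n. c \<le> real n * p 2 n) sequentially"
    by (auto elim: eventually_mono)
  then show "(\<lambda>n. measure_pmf.prob (random_graph p n)
      {\<Gamma>. \<not> hyperbolic_group (coxeter_group n \<Gamma>)}) \<longlonglongrightarrow> 1"
    using prob_not_hyperbolic_tendsto[OF assms(1,2) filterlim_ident, of c] c(1) by simp
next
  obtain c where c: "0 < c" "\<not> eventually (\<lambda>n. \<bar>real n * p 2 n\<bar> < c) sequentially"
    using assms(3) by (auto simp: tendsto_iff dist_real_def)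
  have nonneg: "0 \<le> p 2 n" for n
    using assms(1) by (auto simp: label_probabilities_def)
  have "frequently (\<lambda>n. c \<le> real n * p 2 n) sequentially"
    using c(2) nonneg by (simp add: frequently_def not_le)
  then have inf: "infinite {n. c \<le> real n * p 2 n}"
    by (simp add: frequently_cofinite[symmetric] cofinite_eq_sequentially)
  let ?r = "enumerate {n. c \<le> real n * p 2 n}"
  have r: "strict_mono ?r" using strict_mono_enumerate[OF inf] .
  have "(\<lambda>k. measure_pmf.prob (random_graph p (?r k))
      {\<Gamma>. \<not> hyperbolic_group (coxeter_group (?r k) \<Gamma>)}) \<longlonglongrightarrow> 1"
    using enumerate_in_set[OF inf]
    by (intro prob_not_hyperbolic_tendsto[OF assms(1,2) filterlim_subseq[OF r] c(1)]) auto
  then show "\<exists>r. strict_mono r \<and> (\<lambda>k. measure_pmf.prob (random_graph p (r k))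
      {\<Gamma>. \<not> hyperbolic_group (coxeter_group (r k) \<Gamma>)}) \<longlonglongrightarrow> 1"
    using r by blast
qed

end
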